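(* Let $\alpha>1$ and let $\theta\in[0,1]$ be irrational. The following are equivalent. (1) The Sturmian subshift of slope $\theta$ is $\alpha$-repetitive. (2) The Sturmian subshift of slope $\theta$ is $\alpha$-repulsive. (3) The Sturmian subshift of slope $\theta$ is $\alpha$-finite. (4) The slope $\theta$ is well-approximable of $\alpha$-type.
   Context: Continued fractions: for irrational $\theta\in[0,1]$ write $\theta=[0;a_1,a_2,\dots]$ with $a_n\in\mathbb{N}=\{1,2,\dots\}$, and set $q_0=1$, $q_1=a_1$, $q_n=a_nq_{n-1}+q_{n-2}$ for $n\ge2$. Let $A_\alpha(\theta)=\limsup_{n\to\infty}a_nq_{n-1}^{1-\alpha}$. Then $\theta$ is well-approximable of $\alpha$-type if $0<A_\alpha(\theta)<\infty$. Sturmian subshift: $\{0,1\}^{\mathbb{N}}$ carries the product topology and $\sigma$ is the left shift. The Sturmian subshift of slope $\theta$ is the closure in $\{0,1\}^{\mathbb N}$ of $\{\sigma^k(x):k\ge0\}$, where $x=(x_n)_{n\in\mathbb{N}}$, $x_n=\lceil\theta(n+1)\rceil-\lceil\theta n\rceil$. For a subshift $Y\subseteq\{0,1\}^{\mathbb N}$ the language $\mathcal{L}(Y)$ is the set of all finite factors of elements of $Y$ (including the empty word $\emptyset$); $|w|$ is the length of a word $w$, and $W^p$ is the $p$-fold concatenation of $W$. $\alpha$-repetitive: let $R(r)$ be the smallest $r'$ such that every element of $\mathcal{L}(Y)$ of length $r'$ contains as factors all elements of $\mathcal{L}(Y)$ of length $r$. $Y$ is $\alpha$-repetitive if $R_\alpha=\limsup_{n\to\infty}R(n)/n^\alpha$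 is finite and non-zero. $\alpha$-repulsive: for $n\ge2$ let $$A_{\alpha,n}=\inf\left\{\frac{|W|-|w|}{|w|^{1/\alpha}}: w,W\in\mathcal{L}(Y),\ w\text{ is a prefix and suffix of }W,\ |W|=n,\ W\ne w\ne\emptyset\right\}.$$ $Y$ is $\alpha$-repulsive if $\ell_\alpha=\liminf_{n\to\infty}A_{\alpha,n}$ is finite and non-zero. $\alpha$-finite: let $Q(n)=\sup\{p\in\mathbb{N}:\text{there exists }W\in\mathcal{L}(Y)\text{ with }|W|=n\text{ and }W^p\in\mathcal{L}(Y)\}$. $Y$ is $\alpha$-finite if $Q_\alpha=\limsup_{n\to\infty}Q(n)/n^{\alpha-1}$ is finite and non-zero. *)

theory Defs
  imports "HOL-Analysis.Analysis" "HOL-Library.Sublist"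
begin

section \<open>Continued fractions\<close>

text \<open>Partial quotients are produced by the Gauss map: \<open>cf_rem \<theta> n\<close> is the \<open>n\<close>-th iterate, so that
  \<open>\<theta> = [0; a\<^sub>1, \<dots>, a\<^sub>n + cf_rem \<theta> n]\<close> for irrational \<open>\<theta>\<close> in the unit interval (one step of this is
  \<open>cf_rem_step\<close> below). The value \<open>cf_digit \<theta> 0\<close> is meaningless and never used.\<close>

primrec cf_rem :: "real \<Rightarrow> nat \<Rightarrow> real" where
  "cf_rem \<theta> 0 = \<theta>"
| "cf_rem \<theta> (Suc n) = frac (1 / cf_rem \<theta> n)"

definition cf_digit :: "real \<Rightarrow> nat \<Rightarrow> nat" where
  "cf_digit \<theta> n = nat \<lfloor>1 / cf_rem \<theta> (n - 1)\<rfloor>"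

fun cf_denom :: "real \<Rightarrow> nat \<Rightarrow> nat" where
  "cf_denom \<theta> 0 = 1"
| "cf_denom \<theta> (Suc 0) = cf_digit \<theta> 1"
| "cf_denom \<theta> (Suc (Suc n)) =
     cf_digit \<theta> (Suc (Suc n)) * cf_denom \<theta> (Suc n) + cf_denom \<theta> n"

lemma cf_rem_irrational:
  assumes "\<theta> \<notin> \<rat>" "\<theta> \<in> {0..1}"
  shows "cf_rem \<theta> n \<notin> \<rat> \<and> 0 < cf_rem \<theta> n \<and> cf_rem \<theta> n < 1"
proof (induction n)
  case 0
  have "\<theta> \<noteq> 0" "\<theta> \<noteq> 1" using assms by auto
  then show ?case using assms by simp
next
  case (Suc n)
  define y where "y = 1 / cf_rem \<theta> n"
  have y: "y \<notin> \<rat>"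
  proof
    assume "y \<in> \<rat>"
    then have "1 / y \<in> \<rat>" by simp
    then show False using Suc by (simp add: y_def)
  qed
  have "frac y \<notin> \<rat>"
  proof
    assume "frac y \<in> \<rat>"
    then have "frac y + of_int \<lfloor>y\<rfloor> \<in> \<rat>" by (intro Rats_add Rats_of_int)
    then show False using y by (simp add: frac_def)
  qed
  moreover from this have "frac y \<noteq> 0" by (metis Rats_0)
  ultimately show ?case
    using frac_ge_0[of y] frac_lt_1[of y] by (simp add: y_def)
qed

lemma cf_rem_step:
  assumes "\<theta> \<notin> \<rat>" "\<theta> \<in> {0..1}"
  shows "cf_digit \<theta> (Suc n) \<ge> 1"
    and "cf_rem \<theta> n = 1 / (real (cf_digit \<theta> (Suc n)) + cf_rem \<theta> (Suc n))"
proof -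
  have r: "0 < cf_rem \<theta> n" "cf_rem \<theta> n < 1" using cf_rem_irrational[OF assms] by auto
  then have "1 / cf_rem \<theta> n > 1" by simp
  then have f: "\<lfloor>1 / cf_rem \<theta> n\<rfloor> \<ge> 1" by linarith
  then show "cf_digit \<theta> (Suc n) \<ge> 1" by (simp add: cf_digit_def le_nat_iff del: le_floor_iff one_le_floor)
  show "cf_rem \<theta> n = 1 / (real (cf_digit \<theta> (Suc n)) + cf_rem \<theta> (Suc n))"
    using f r by (simp add: cf_digit_def frac_def)
qed

definition approx_limsup :: "real \<Rightarrow> real \<Rightarrow> ereal" where
  "approx_limsup \<alpha> \<theta> =
     limsup (\<lambda>n. ereal (real (cf_digit \<theta> n) * real (cf_denom \<theta> (n - 1)) powr (1 - \<alpha>)))"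

definition well_approximable :: "real \<Rightarrow> real \<Rightarrow> bool" where
  "well_approximable \<alpha> \<theta> \<longleftrightarrow> 0 < approx_limsup \<alpha> \<theta> \<and> approx_limsup \<alpha> \<theta> < \<infinity>"

section \<open>Sturmian subshifts\<close>

definition full_shift :: "(nat \<Rightarrow> int) topology" where
  "full_shift = product_topology (\<lambda>_. discrete_topology {0, 1}) UNIV"

definition shift :: "(nat \<Rightarrow> 'a) \<Rightarrow> nat \<Rightarrow> 'a" where
  "shift y = (\<lambda>i. y (Suc i))"

text \<open>Sequences are classically indexed from 1; here position \<open>i\<close> carries the entry with
  classical index \<open>i + 1\<close>, namely \<open>x\<^sub>n = \<lceil>\<theta>(n + 1)\<rceil> - \<lceil>\<theta>n\<rceil>\<close> with \<open>n = i + 1\<close>.\<close>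

definition sturmian_seq :: "real \<Rightarrow> nat \<Rightarrow> int" where
  "sturmian_seq \<theta> i = \<lceil>\<theta> * real (i + 2)\<rceil> - \<lceil>\<theta> * real (i + 1)\<rceil>"

definition sturmian_subshift :: "real \<Rightarrow> (nat \<Rightarrow> int) set" where
  "sturmian_subshift \<theta> = full_shift closure_of {(shift ^^ k) (sturmian_seq \<theta>) | k. True}"

section \<open>Complexity notions for subshifts\<close>

definition language :: "(nat \<Rightarrow> 'a) set \<Rightarrow> 'a list set" where
  "language Y = {map y [i..<i + n] | y i n. y \<in> Y}"

text \<open>The infimum of a nonempty set of type \<open>enat\<close> is its least element; it is \<open>\<infinity>\<close> if
  no such length exists.\<close>

definition repetitivity :: "(nat \<Rightarrow> 'a) set \<Rightarrow> nat \<Rightarrow> enat" where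
  "repetitivity Y r = (INF r' \<in> {r'. \<forall>W \<in> language Y. length W = r' \<longrightarrow>
     (\<forall>w \<in> language Y. length w = r \<longrightarrow> sublist w W)}. enat r')"

definition repetitive_limsup :: "real \<Rightarrow> (nat \<Rightarrow> 'a) set \<Rightarrow> ereal" where
  "repetitive_limsup \<alpha> Y =
     limsup (\<lambda>n. ereal_of_enat (repetitivity Y n) / ereal (real n powr \<alpha>))"

definition repetitive :: "real \<Rightarrow> (nat \<Rightarrow> 'a) set \<Rightarrow> bool" where
  "repetitive \<alpha> Y \<longleftrightarrow> \<bar>repetitive_limsup \<alpha> Y\<bar> \<noteq> \<infinity> \<and> repetitive_limsup \<alpha> Y \<noteq> 0"

definition repulsion :: "real \<Rightarrow> (nat \<Rightarrow> 'a) set \<Rightarrow> nat \<Rightarrow> ereal" where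
  "repulsion \<alpha> Y n = Inf {ereal ((real (length W) - real (length w)) / real (length w) powr (1 / \<alpha>)) | w W.
     w \<in> language Y \<and> W \<in> language Y \<and> prefix w W \<and> suffix w W \<and> length W = n \<and> W \<noteq> w \<and> w \<noteq> []}"

definition repulsive_liminf :: "real \<Rightarrow> (nat \<Rightarrow> 'a) set \<Rightarrow> ereal" where
  "repulsive_liminf \<alpha> Y = liminf (repulsion \<alpha> Y)"

definition repulsive :: "real \<Rightarrow> (nat \<Rightarrow> 'a) set \<Rightarrow> bool" where
  "repulsive \<alpha> Y \<longleftrightarrow> \<bar>repulsive_liminf \<alpha> Y\<bar> \<noteq> \<infinity> \<and> repulsive_liminf \<alpha> Y \<noteq> 0"

definition max_power :: "(nat \<Rightarrow> 'a) set \<Rightarrow> nat \<Rightarrow> enat" where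
  "max_power Y n = (SUP p \<in> {p. p \<ge> 1 \<and>
     (\<exists>W \<in> language Y. length W = n \<and> concat (replicate p W) \<in> language Y)}. enat p)"

definition finite_limsup :: "real \<Rightarrow> (nat \<Rightarrow> 'a) set \<Rightarrow> ereal" where
  "finite_limsup \<alpha> Y =
     limsup (\<lambda>n. ereal_of_enat (max_power Y n) / ereal (real n powr (\<alpha> - 1)))"

definition power_finite :: "real \<Rightarrow> (nat \<Rightarrow> 'a) set \<Rightarrow> bool" where
  "power_finite \<alpha> Y \<longleftrightarrow> \<bar>finite_limsup \<alpha> Y\<bar> \<noteq> \<infinity> \<and> finite_limsup \<alpha> Y \<noteq> 0"

end

theory Submission
  imports Defs
begin

text \<open>Each of the four properties says that \<open>q (k + 1) / q k powr \<alpha>\<close> has a finite and positive upper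
  limit; only estimates up to constant factors are needed, so the exact formulas for the complexity
  functions are avoided. Two facts about the rotation by \<open>\<theta>\<close> give all of them. First, by best
  approximation, the sequence starts with a word of length \<open>q (k + 1) + q k - 2\<close> and period \<open>q k\<close>.
  Second, for \<open>n < q (k + 1)\<close> a word of length \<open>q (k + 1) + q k + n\<close> contains all words of
  length \<open>n\<close>, hence it does not have period \<open>n\<close>: in a word of period \<open>n\<close> all factors of length \<open>n\<close>
  have the same digit sum, whereas two digit sums must occur since \<open>n * \<theta>\<close> is not an integer.\<close>

section \<open>Convergents\<close>

text \<open>Numerators of the convergents, taken as integers so that differences do not
  truncate.\<close>

fun cf_num :: "real \<Rightarrow> nat \<Rightarrow> int" where
  "cf_num \<theta> 0 = 0"
| "cf_num \<theta> (Suc 0) = 1"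
| "cf_num \<theta> (Suc (Suc n)) =
     int (cf_digit \<theta> (Suc (Suc n))) * cf_num \<theta> (Suc n) + cf_num \<theta> n"

text \<open>For irrational \<theta> in the unit interval this is the distance between
  \<open>cf_denom \<theta> k * \<theta>\<close> and \<open>cf_num \<theta> k\<close> (see
  \<open>err_eq\<close>). The product form shows that it is positive and decreases with
  \<open>k\<close>.\<close>

definition cf_err :: "real \<Rightarrow> nat \<Rightarrow> real" where
  "cf_err \<theta> k = (\<Prod>i\<le>k. cf_rem \<theta> i)"

text \<open>The recurrence is a column operation followed by a swap, so passing to the next pair of
  convergents only flips the sign of the determinant.\<close>

lemma cf_det:
  "int (cf_denom \<theta> (Suc k)) * cf_num \<theta> k - int (cf_denom \<theta> k) * cf_num \<theta> (Suc k) = (-1) ^ Suc k"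
proof (induction k)
  case (Suc k)
  have "int (cf_denom \<theta> (Suc (Suc k))) * cf_num \<theta> (Suc k) - int (cf_denom \<theta> (Suc k)) * cf_num \<theta> (Suc (Suc k))
     = - (int (cf_denom \<theta> (Suc k)) * cf_num \<theta> k - int (cf_denom \<theta> k) * cf_num \<theta> (Suc k))"
    by (simp add: algebra_simps)
  then show ?case using Suc by simp
qed simp

locale irrational_slope =
  fixes \<theta> :: real
  assumes irr: "\<theta> \<notin> \<rat>" and unit_interval: "\<theta> \<in> {0..1}"
begin

abbreviation "q \<equiv> cf_denom \<theta>"
abbreviation "\<eta> \<equiv> cf_err \<theta>"

declare cf_rem.simps(2) [simp del] cf_denom.simps(3) [simp del]

lemma theta_bounds: "0 < \<theta>" "\<theta> < 1"
  using cf_rem_irrational[OF irr unit_interval, of 0] by auto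

lemma digit_pos: "cf_digit \<theta> (Suc n) \<ge> 1"
  using cf_rem_step[OF irr unit_interval] by blast

lemma rem_bounds: "0 < cf_rem \<theta> n" "cf_rem \<theta> n < 1"
  using cf_rem_irrational[OF irr unit_interval] by auto

lemma int_combination_neq:
  fixes m N :: int
  assumes "real_of_int m * \<theta> = real_of_int N"
  shows "m = 0"
proof (rule ccontr)
  assume "m \<noteq> 0"
  then have "\<theta> = of_int N / of_int m" using assms by (simp add: field_simps)
  then show False using irr by simp
qed

section \<open>Growth of the denominators\<close>

lemma denom_pos: "q k \<ge> 1"
proof (induction k rule: less_induct)
  case (less k)
  show ?case
  proof (cases k)
    case (Suc m)
    then show ?thesis using digit_pos[of m] less[of "m - 1"] by (cases m) (auto simp: cf_denom.simps(3))
  qed simp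
qed

lemma denom_rec_ge: "q (Suc (Suc k)) \<ge> q (Suc k) + q k"
  using mult_le_mono1[OF digit_pos[of "Suc k"], of "q (Suc k)"] by (simp add: cf_denom.simps(3))

lemma denom_mono_Suc: "q k \<le> q (Suc k)"
  using denom_rec_ge[of "k - 1"] denom_pos[of "Suc 0"] by (cases k) auto

lemma denom_mono: "j \<le> k \<Longrightarrow> q j \<le> q k"
  by (rule lift_Suc_mono_le[of q]) (use denom_mono_Suc in auto)

lemma denom_ge_self: "q k \<ge> k"
proof (induction k)
  case (Suc k)
  show ?case
  proof (cases k)
    case 0
    then show ?thesis using denom_pos[of "Suc 0"] by simp
  next
    case (Suc m)
    then show ?thesis using denom_rec_ge[of m] denom_pos[of m] Suc.IH by simp
  qed
qed simp

text \<open>The denominators are unbounded, so a least \<open>k\<close> with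
  \<open>n < q (Suc k)\<close> exists. Minimality gives \<open>q k \<le> n\<close>, except for
  \<open>k = 0\<close>, where \<open>q 0 = 1\<close> is used.\<close>

lemma denom_bracket:
  assumes "n \<ge> 1"
  obtains k where "q k \<le> n" "n < q (Suc k)"
proof -
  define k where "k = (LEAST k. n < q (Suc k))"
  have "n < q (Suc n)" using denom_ge_self[of "Suc n"] by simp
  then have 1: "n < q (Suc k)" unfolding k_def by (rule LeastI)
  have "q k \<le> n"
  proof (cases k)
    case (Suc m)
    then have "\<not> n < q (Suc m)" using not_less_Least[of m "\<lambda>k. n < q (Suc k)"] k_def by simp
    then show ?thesis using Suc by simp
  qed (use assms in simp)
  with 1 that show ?thesis by blast
qed

section \<open>Approximation errors of the convergents\<close>

lemma err_pos: "0 < \<eta> k"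
  unfolding cf_err_def using rem_bounds by (intro prod_pos) auto

lemma err_Suc: "\<eta> (Suc k) = \<eta> k * cf_rem \<theta> (Suc k)"
  by (simp add: cf_err_def)

lemma err_mono: "\<eta> (Suc k) \<le> \<eta> k"
  unfolding err_Suc using err_pos[of k] rem_bounds[of "Suc k"] by (simp add: mult_left_le)

lemma rem_rec: "cf_rem \<theta> n * (real (cf_digit \<theta> (Suc n)) + cf_rem \<theta> (Suc n)) = 1"
proof -
  have "real (cf_digit \<theta> (Suc n)) + cf_rem \<theta> (Suc n) > 0"
    using rem_bounds[of "Suc n"] by (simp add: add_nonneg_pos)
  then show ?thesis
    by (subst cf_rem_step(2)[OF irr unit_interval, of n]) simp
qed

text \<open>Denominators, numerators and signed errors satisfy the same two-term recurrence, the
  errors because of \<open>rem_rec\<close>. The induction therefore carries two consecutive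
  indices.\<close>

lemma err_eq: "real (q k) * \<theta> - of_int (cf_num \<theta> k) = (-1) ^ k * \<eta> k"
proof -
  have "real (q k) * \<theta> - of_int (cf_num \<theta> k) = (-1) ^ k * \<eta> k \<and>
    real (q (Suc k)) * \<theta> - of_int (cf_num \<theta> (Suc k)) = (-1) ^ Suc k * \<eta> (Suc k)"
  proof (induction k)
    case 0
    have "\<theta> * (real (cf_digit \<theta> 1) + cf_rem \<theta> 1) = 1" using rem_rec[of 0] by simp
    then show ?case by (simp add: cf_err_def algebra_simps)
  next
    case (Suc k)
    have "\<eta> k = \<eta> k * (cf_rem \<theta> (Suc k) * (real (cf_digit \<theta> (Suc (Suc k))) + cf_rem \<theta> (Suc (Suc k))))"
      by (simp add: rem_rec)
    then have *: "\<eta> k = \<eta> (Suc k) * real (cf_digit \<theta> (Suc (Suc k))) + \<eta> (Suc (Suc k))"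
      by (simp add: err_Suc algebra_simps)
    have "real (q (Suc (Suc k))) * \<theta> - of_int (cf_num \<theta> (Suc (Suc k)))
      = real (cf_digit \<theta> (Suc (Suc k))) * (real (q (Suc k)) * \<theta> - of_int (cf_num \<theta> (Suc k)))
        + (real (q k) * \<theta> - of_int (cf_num \<theta> k))"
      by (simp add: cf_denom.simps(3) algebra_simps)
    also have "\<dots> = real (cf_digit \<theta> (Suc (Suc k))) * ((-1) ^ Suc k * \<eta> (Suc k)) + (-1) ^ k * \<eta> k"
      using Suc by simp
    also have "\<dots> = (-1) ^ Suc (Suc k) * \<eta> (Suc (Suc k))"
      by (subst *) (simp add: algebra_simps)
    finally show ?case using Suc by blast
  qed
  then show ?thesis by blast
qed

text \<open>Expanding \<open>(u, N)\<close> in the unimodular basis of two consecutive convergents, the two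
  coefficients have opposite signs, and so do the two errors, so nothing cancels.\<close>

lemma best_approximation:
  fixes u N :: int
  assumes "\<bar>u\<bar> < int (q (Suc k))" and nz: "u \<noteq> 0 \<or> N \<noteq> 0"
  shows "\<bar>of_int u * \<theta> - of_int N\<bar> \<ge> \<eta> k"
proof -
  define Q0 Q1 P0 P1 :: int where "Q0 = int (q k)" "Q1 = int (q (Suc k))"
    "P0 = cf_num \<theta> k" "P1 = cf_num \<theta> (Suc k)"
  note d = this
  define e :: int where "e = (-1) ^ Suc k"
  have det: "Q1 * P0 - Q0 * P1 = e" using cf_det[of \<theta> k] by (simp add: d e_def)
  have ee: "e * e = 1" unfolding e_def by (simp flip: power_mult_distrib)
  \<comment> \<open>Cramer's rule: the determinant \<open>e\<close> is its own inverse, so the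
    coefficients are integers.\<close>
  define A B where "A = e * (Q1 * N - u * P1)" and "B = e * (u * P0 - Q0 * N)"
  have u: "u = A * Q0 + B * Q1"
  proof -
    have "A * Q0 + B * Q1 = e * (u * (Q1 * P0 - Q0 * P1))"
      unfolding A_def B_def by (simp add: algebra_simps)
    then show ?thesis using det ee by (simp add: mult.left_commute)
  qed
  have N: "N = A * P0 + B * P1"
  proof -
    have "A * P0 + B * P1 = e * (N * (Q1 * P0 - Q0 * P1))"
      unfolding A_def B_def by (simp add: algebra_simps)
    then show ?thesis using det ee by (simp add: mult.left_commute)
  qed
  have pos: "Q0 \<ge> 1" "Q1 \<ge> 1" using denom_pos[of k] denom_pos[of "Suc k"] d by auto
  have small: "\<bar>u\<bar> < Q1" using assms d by simp
  define g where "g = (-1::real) ^ k"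
  have g: "\<bar>g\<bar> = 1" by (simp add: g_def power_abs)
  have E: "of_int Q0 * \<theta> - of_int P0 = g * \<eta> k" "of_int Q1 * \<theta> - of_int P1 = - g * \<eta> (Suc k)"
    using err_eq[of k] err_eq[of "Suc k"] by (simp_all add: d g_def)
  have "of_int u * \<theta> - of_int N
    = of_int A * (of_int Q0 * \<theta> - of_int P0) + of_int B * (of_int Q1 * \<theta> - of_int P1)"
    by (simp add: u N algebra_simps)
  also have "\<dots> = g * (of_int A * \<eta> k - of_int B * \<eta> (Suc k))"
    unfolding E by (simp add: algebra_simps)
  finally have val: "\<bar>of_int u * \<theta> - of_int N\<bar> = \<bar>of_int A * \<eta> k - of_int B * \<eta> (Suc k)\<bar>"
    using g by (simp add: abs_mult)
  \<comment> \<open>With \<open>A = 0\<close>, \<open>u\<close> would be a nonzero multiple of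
    \<open>Q1\<close>, hence too large.\<close>
  have A0: "A \<noteq> 0"
  proof
    assume A: "A = 0"
    have "B \<noteq> 0" using nz u N A by auto
    then have "\<bar>B\<bar> * Q1 \<ge> 1 * Q1" using pos by (intro mult_right_mono) auto
    then show False using small u A pos by (simp add: abs_mult)
  qed
  have e0: "0 < \<eta> k" "0 < \<eta> (Suc k)" using err_pos by auto
  \<comment> \<open>Only the first two cases can occur: in the others the absolute value of
    \<open>u\<close> is at least \<open>Q1\<close>.\<close>
  consider "A \<ge> 1" "B \<le> 0" | "A \<le> -1" "B \<ge> 0" | "A \<ge> 1" "B \<ge> 1" | "A \<le> -1" "B \<le> -1"
    using A0 by linarith
  then show ?thesis
  proof cases
    case 1
    have "real_of_int A * \<eta> k \<ge> 1 * \<eta> k" using 1 e0 by (intro mult_right_mono) auto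
    moreover have "of_int B * \<eta> (Suc k) \<le> 0" using 1 e0 by (intro mult_nonpos_nonneg) auto
    ultimately show ?thesis unfolding val by linarith
  next
    case 2
    have "real_of_int (-A) * \<eta> k \<ge> 1 * \<eta> k" using 2 e0 by (intro mult_right_mono) auto
    moreover have "of_int B * \<eta> (Suc k) \<ge> 0" using 2 e0 by (intro mult_nonneg_nonneg) auto
    ultimately show ?thesis unfolding val by simp
  next
    case 3
    have "A * Q0 \<ge> 0" "B * Q1 \<ge> 1 * Q1" using 3 pos by (intro mult_right_mono mult_nonneg_nonneg, auto)+
    then show ?thesis using small u by simp
  next
    case 4
    have "A * Q0 \<le> 0" using 4 pos by (intro mult_nonpos_nonneg) auto
    moreover have "B * Q1 \<le> (-1) * Q1" using 4 pos by (intro mult_right_mono) auto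
    ultimately show ?thesis using small u by simp
  qed
qed

section \<open>Factors of the Sturmian sequence\<close>

text \<open>The digits are the differences of \<open>S\<close>, so digit sums telescope and
  statements about words become statements about ceilings. The offset 1 comes from the classical
  indexing of the sequence.\<close>

definition S :: "nat \<Rightarrow> int" where "S i = \<lceil>\<theta> * real (i + 1)\<rceil>"

definition factor :: "nat \<Rightarrow> nat \<Rightarrow> int list" where
  "factor i n = map (sturmian_seq \<theta>) [i..<i + n]"

lemma sturmian_seq_eq: "sturmian_seq \<theta> i = S (Suc i) - S i"
  by (simp add: sturmian_seq_def S_def add.commute)

lemma length_factor [simp]: "length (factor i n) = n"
  by (simp add: factor_def)

lemma nth_factor: "j < n \<Longrightarrow> factor i n ! j = S (i + Suc j) - S (i + j)"
  by (simp add: factor_def sturmian_seq_eq)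

lemma sum_list_factor: "sum_list (factor i n) = S (i + n) - S i"
  by (induction n) (simp_all add: factor_def sturmian_seq_eq)

lemma factor_eqI:
  assumes "\<And>j. j \<le> n \<Longrightarrow> S (m + j) - S m = S (i + j) - S i"
  shows "factor m n = factor i n"
proof (rule nth_equalityI)
  fix j assume "j < length (factor m n)"
  then have j: "j < n" by simp
  then show "factor m n ! j = factor i n ! j"
    using assms[of j] assms[of "Suc j"] by (simp add: nth_factor)
qed simp

lemma take_factor: "take m (factor i n) = factor i (min m n)"
  by (rule nth_equalityI) (auto simp: nth_factor)

lemma drop_factor: "drop m (factor i n) = factor (i + m) (n - m)"
  by (rule nth_equalityI) (auto simp: nth_factor algebra_simps)

section \<open>The language of the subshift\<close>

lemma sturmian_seq_01: "sturmian_seq \<theta> i \<in> {0, 1}"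
proof -
  have "\<theta> * real (i + 2) = \<theta> * real (i + 1) + \<theta>" by (simp add: algebra_simps)
  then show ?thesis unfolding sturmian_seq_def using theta_bounds
    by (simp only: insert_iff empty_iff) linarith
qed

lemma shift_pow: "(shift ^^ k) y = (\<lambda>i. y (i + k))"
  by (induction k arbitrary: y) (auto simp: shift_def fun_eq_iff)

text \<open>Passing to the closure adds no words: the sequences that agree with a limit point
  \<open>y\<close> on a finite window form an open cylinder \<open>T\<close>, which must meet the
  orbit.\<close>

lemma language_sturmian: "language (sturmian_subshift \<theta>) = {factor i n | i n. True}"
proof -
  define Orb where "Orb = {(shift ^^ k) (sturmian_seq \<theta>) | k. True}"
  have top: "topspace full_shift = (UNIV \<rightarrow>\<^sub>E {0, 1})" by (simp add: full_shift_def)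
  have Orb: "Orb \<subseteq> topspace full_shift"
    unfolding top Orb_def using sturmian_seq_01 by (auto simp: shift_pow)
  show ?thesis
  proof (intro equalityI subsetI)
    fix w assume "w \<in> language (sturmian_subshift \<theta>)"
    then obtain y i n where w: "w = map y [i..<i + n]" and y: "y \<in> full_shift closure_of Orb"
      unfolding language_def sturmian_subshift_def Orb_def by blast
    define T where "T = (\<Pi>\<^sub>E j\<in>UNIV. if j \<in> {i..<i+n} then {y j} else {0,1::int})"
    have ytop: "y \<in> UNIV \<rightarrow>\<^sub>E {0, 1}" using y by (simp add: in_closure_of top)
    have "openin full_shift T" unfolding full_shift_def T_def
    proof (rule product_topology_basis)
      have "y j \<in> {0,1}" for j using ytop by (auto simp: PiE_def Pi_def)
      then show "openin (discrete_topology {0, 1}) (if j \<in> {i..<i+n} then {y j} else {0, 1})" for j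
        by auto
      show "finite {j. (if j \<in> {i..<i+n} then {y j} else {0, 1}) \<noteq> topspace (discrete_topology {0, 1})}"
        by (rule finite_subset[of _ "{i..<i+n}"]) auto
    qed
    moreover have "y \<in> T" using ytop unfolding T_def by (auto simp: PiE_def Pi_def)
    ultimately obtain z where "z \<in> Orb" "z \<in> T" using y by (auto simp: in_closure_of)
    then obtain k where z: "z = (\<lambda>i. sturmian_seq \<theta> (i + k))" by (auto simp: Orb_def shift_pow)
    have "y j = z j" if "j \<in> {i..<i+n}" for j
      using \<open>z \<in> T\<close> that unfolding T_def by (auto simp: PiE_iff split: if_splits) 
    then have "w = factor (i + k) n"
      unfolding w factor_def z by (intro nth_equalityI) (auto simp: algebra_simps)
    then show "w \<in> {factor i n | i n. True}" by blast
  next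
    fix w assume "w \<in> {factor i n | i n. True}"
    then obtain i n where w: "w = factor i n" by blast
    have "sturmian_seq \<theta> = (shift ^^ 0) (sturmian_seq \<theta>)" by simp
    then have "sturmian_seq \<theta> \<in> Orb" unfolding Orb_def by blast
    then have "sturmian_seq \<theta> \<in> sturmian_subshift \<theta>"
      using closure_of_subset[OF Orb] unfolding sturmian_subshift_def Orb_def by blast
    then show "w \<in> language (sturmian_subshift \<theta>)"
      unfolding w factor_def language_def by blast
  qed
qed

lemma take_in_language:
  assumes "w \<in> language (sturmian_subshift \<theta>)"
  shows "take m w \<in> language (sturmian_subshift \<theta>)"
  using assms unfolding language_sturmian by (force simp: take_factor)

text \<open>If all these sums were equal to \<open>p\<close>, then \<open>S\<close> would grow by
  exactly \<open>p\<close> over every block of length \<open>n\<close>. But \<open>S i\<close> stays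
  within 1 of \<open>\<theta> * (i + 1)\<close>, so over \<open>j\<close> blocks the discrepancy
  \<open>j * (p - n * \<theta>)\<close> is bounded, which forces
  \<open>n * \<theta> = p\<close>.\<close>

lemma factor_sums_vary:
  assumes n: "n \<ge> 1"
  obtains i j where "sum_list (factor i n) \<noteq> sum_list (factor j n)"
proof (rule ccontr)
  assume c: "\<not> thesis"
  define p where "p = S n - S 0"
  have step: "S (i + n) = S i + p" for i
  proof -
    have "sum_list (factor i n) = sum_list (factor 0 n)" using c that by blast
    then show ?thesis by (simp add: sum_list_factor p_def)
  qed
  have mult: "S (j * n) = S 0 + int j * p" for j
  proof (induction j)
    case (Suc j)
    have "S (Suc j * n) = S (j * n + n)" by (simp add: add.commute)
    then show ?case unfolding step using Suc by (simp add: algebra_simps)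
  qed simp
  have bd: "\<bar>real j * (of_int p - real n * \<theta>)\<bar> \<le> 2" for j
  proof -
    have "\<bar>of_int (S i) - \<theta> * real (i + 1)\<bar> \<le> 1" for i unfolding S_def by linarith
    from this[of "j * n"] this[of 0]
    have "\<bar>(of_int (S (j * n)) - of_int (S 0)) - \<theta> * real (j * n)\<bar> \<le> 2"
      by (simp add: algebra_simps)
    then show ?thesis using mult[of j] by (simp add: algebra_simps)
  qed
  have "of_int p - real n * \<theta> = 0"
  proof (rule ccontr)
    assume nz: "of_int p - real n * \<theta> \<noteq> 0"
    obtain j where "real j * \<bar>of_int p - real n * \<theta>\<bar> > 2"
      using reals_Archimedean3[of "\<bar>of_int p - real n * \<theta>\<bar>"] nz by auto
    then show False using bd[of j] by (simp add: abs_mult)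
  qed
  then have "real_of_int (int n) * \<theta> = of_int p" by simp
  from int_combination_neq[OF this] n show False by simp
qed

text \<open>Raising the index by \<open>q k\<close> moves the argument of the ceiling by an integer
  plus an error of size \<open>\<eta> k\<close>. For small indices best approximation keeps the
  argument at least that far from every integer, so the ceiling changes by the integer
  alone.\<close>

lemma factor_periodic:
  assumes "i + q k < q (Suc k) + q k - 2"
  shows "factor 0 (q (Suc k) + q k - 2) ! (i + q k) = factor 0 (q (Suc k) + q k - 2) ! i"
proof -
  have shift: "S (m + q k) = S m + cf_num \<theta> k" if m: "m + 1 < q (Suc k)" for m
  proof -
    define g where "g = (-1::real) ^ k * \<eta> k"
    have gq: "real (q k) * \<theta> = of_int (cf_num \<theta> k) + g" using err_eq[of k] by (simp add: g_def)
    have ga: "\<bar>g\<bar> = \<eta> k" using err_pos[of k] by (simp add: g_def abs_mult power_abs)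
    define t where "t = \<theta> * real (m + 1)"
    have "\<lceil>t + g\<rceil> = \<lceil>t\<rceil>"
    proof -
      have far: "\<bar>t - of_int N\<bar> \<ge> \<bar>g\<bar>" for N
        using best_approximation[of "int (m + 1)" k N] m by (simp add: ga t_def mult.commute)
      \<comment> \<open>Distance at least \<open>\<eta> k\<close> still permits landing exactly on
        the integer below, where the ceiling would drop; irrationality rules this out.\<close>
      have ne: "t + g \<noteq> of_int N" for N
      proof
        assume "t + g = of_int N"
        then have "real_of_int (int (m + 1 + q k)) * \<theta> = of_int (N + cf_num \<theta> k)"
          using gq by (simp add: t_def algebra_simps)
        from int_combination_neq[OF this] show False by simp
      qed
      show ?thesis
        using far[of "\<lceil>t\<rceil>"] far[of "\<lceil>t\<rceil> - 1"] ne[of "\<lceil>t\<rceil> - 1"]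
        by (intro ceiling_unique) (auto split: abs_split | linarith)+
    qed
    moreover have "\<theta> * real (m + q k + 1) = (t + g) + of_int (cf_num \<theta> k)"
      using gq by (simp add: t_def algebra_simps)
    ultimately show ?thesis unfolding S_def by (simp add: t_def)
  qed
  \<comment> \<open>Digit \<open>i\<close> involves \<open>S i\<close> and \<open>S (Suc i)\<close>,
    and the shift is available at \<open>m\<close> only for \<open>m + 1 < q (Suc k)\<close>; this
    accounts for the 2 subtracted from the length.\<close>
  have "i + 2 < q (Suc k)" using assms by simp
  then show ?thesis
    using assms shift[of i] shift[of "Suc i"] by (auto simp: nth_factor add_ac)
qed

end

section \<open>Recurrence of factors\<close>

text \<open>In the next two lemmas one walks through \<open>P\<close> by steps that are too short to jump over
  the interval \<open>{a..<b}\<close>.\<close>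

lemma upward_walk_hits:
  fixes P :: "real set"
  assumes "p \<in> P" "p < b" "0 < \<delta>" "\<epsilon> \<le> b - a"
    and step: "\<And>p. p \<in> P \<Longrightarrow> \<exists>p'\<in>P. p + \<delta> \<le> p' \<and> p' \<le> p + \<epsilon>"
  shows "\<exists>p\<in>P. a \<le> p \<and> p < b"
proof (rule ccontr)
  assume none: "\<not> ?thesis"
  \<comment> \<open>A walk that never enters the interval stays below \<open>a\<close> forever while
    gaining at least \<delta> per step.\<close>
  have "\<exists>p'\<in>P. p' < a \<and> p + real j * \<delta> \<le> p'" for j
  proof (induction j)
    case 0
    then show ?case using assms(1,2) none by force
  next
    case (Suc j)
    then obtain p' where p': "p' \<in> P" "p' < a" "p + real j * \<delta> \<le> p'" by blast
    from step[OF p'(1)] obtain p'' where p'': "p'' \<in> P" "p' + \<delta> \<le> p''" "p'' \<le> p' + \<epsilon>" by blast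
    then have "p'' < b" using p' assms(4) by linarith
    then have "p'' < a" using none p''(1) by force
    moreover have "p + real (Suc j) * \<delta> \<le> p''" using p' p'' by (simp add: algebra_simps)
    ultimately show ?case using p''(1) by blast
  qed
  moreover obtain j where "real j * \<delta> > a - p" using reals_Archimedean3[OF assms(3)] by blast
  ultimately show False by (smt (verit))
qed

lemma downward_walk_hits:
  fixes P :: "real set"
  assumes "p \<in> P" "a \<le> p" "0 < \<delta>" "\<epsilon> \<le> b - a"
    and step: "\<And>p. p \<in> P \<Longrightarrow> \<exists>p'\<in>P. p - \<epsilon> \<le> p' \<and> p' \<le> p - \<delta>"
  shows "\<exists>p\<in>P. a \<le> p \<and> p < b"
proof (rule ccontr)
  assume none: "\<not> ?thesis"
  have "\<exists>p'\<in>P. b \<le> p' \<and> p' \<le> p - real j * \<delta>" for j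
  proof (induction j)
    case 0
    have "b \<le> p" using assms(1,2) none by force
    then show ?case using assms(1) by auto
  next
    case (Suc j)
    then obtain p' where p': "p' \<in> P" "b \<le> p'" "p' \<le> p - real j * \<delta>" by blast
    from step[OF p'(1)] obtain p'' where p'': "p'' \<in> P" "p' - \<epsilon> \<le> p''" "p'' \<le> p' - \<delta>" by blast
    then have "a \<le> p''" using p' assms(4) by linarith
    then have "b \<le> p''" using none p''(1) by force
    moreover have "p'' \<le> p - real (Suc j) * \<delta>" using p' p'' by (simp add: algebra_simps)
    ultimately show ?case using p''(1) by blast
  qed
  moreover obtain j where "real j * \<delta> > p - b" using reals_Archimedean3[OF assms(3)] by blast
  ultimately show False by (smt (verit))
qed

context irrational_slope
begin

text \<open>A window of \<open>q (Suc k) + q k\<close> orbit points contains with each index \<open>m\<close> either \<open>m + q k\<close>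
  or \<open>m - q (Suc k)\<close>, and both moves rotate in the same direction, by an angle between
  \<open>\<eta> (Suc k)\<close> and \<open>\<eta> k\<close>.\<close>

lemma orbit_window_hits:
  assumes "b - a \<ge> \<eta> k"
  obtains m N where "i \<le> m" "m < i + q (Suc k) + q k"
    "a \<le> of_int N - \<theta> * real (m + 1)" "of_int N - \<theta> * real (m + 1) < b"
proof -
  \<comment> \<open>All integers \<open>N\<close> are allowed: \<open>P\<close> is the orbit window
    lifted from the circle to the line, so the walk never has to wrap around.\<close>
  define P where "P = {of_int N - \<theta> * real (m + 1) | N m. i \<le> m \<and> m < i + q (Suc k) + q k}"
  have PI: "of_int N - \<theta> * real (m + 1) \<in> P" if "i \<le> m" "m < i + q (Suc k) + q k" for N m
    using that unfolding P_def by blast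
  define g where "g = (-1::real) ^ k"
  have step: "\<exists>t. \<eta> (Suc k) \<le> t \<and> t \<le> \<eta> k \<and> p - g * t \<in> P" if "p \<in> P" for p
  proof -
    obtain N m where p: "p = of_int N - \<theta> * real (m + 1)" and m: "i \<le> m" "m < i + q (Suc k) + q k"
      using \<open>p \<in> P\<close> unfolding P_def by blast
    show ?thesis
    proof (cases "m < i + q (Suc k)")
      case True
      have "p - g * \<eta> k = of_int (N + cf_num \<theta> k) - \<theta> * real (m + q k + 1)"
        using err_eq[of k] by (simp add: p g_def algebra_simps)
      also have "\<dots> \<in> P" by (rule PI) (use m True in auto)
      finally show ?thesis using err_mono[of k] by blast
    next
      case False
      have "p - g * \<eta> (Suc k) = of_int (N - cf_num \<theta> (Suc k)) - \<theta> * real ((m - q (Suc k)) + 1)"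
        using err_eq[of "Suc k"] False by (simp add: p g_def of_nat_diff algebra_simps)
      also have "\<dots> \<in> P" by (rule PI) (use m False in auto)
      finally show ?thesis using err_mono[of k] by blast
    qed
  qed
  have "\<exists>p\<in>P. a \<le> p \<and> p < b"
  proof (cases "even k")
    case True
    \<comment> \<open>For even \<open>k\<close> the moves go down, so the start is lifted to the
      first position at or above \<open>a\<close>.\<close>
    have "of_int \<lceil>a + \<theta> * real (i + 1)\<rceil> - \<theta> * real (i + 1) \<in> P"
      by (rule PI) (use denom_pos[of k] in auto)
    then show ?thesis
    proof (rule downward_walk_hits)
      show "a \<le> of_int \<lceil>a + \<theta> * real (i + 1)\<rceil> - \<theta> * real (i + 1)" by linarith
      fix p assume "p \<in> P"
      from step[OF this] obtain t where "\<eta> (Suc k) \<le> t" "t \<le> \<eta> k" "p - t \<in> P"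
        using True by (auto simp: g_def)
      then show "\<exists>p'\<in>P. p - \<eta> k \<le> p' \<and> p' \<le> p - \<eta> (Suc k)"
        by (intro bexI) auto
    qed (use err_pos assms in auto)
  next
    case False
    \<comment> \<open>For odd \<open>k\<close> the moves go up, so the start is the last position
      strictly below \<open>b\<close>.\<close>
    have "of_int (\<lceil>b + \<theta> * real (i + 1)\<rceil> - 1) - \<theta> * real (i + 1) \<in> P"
      by (rule PI) (use denom_pos[of k] in auto)
    then show ?thesis
    proof (rule upward_walk_hits)
      show "of_int (\<lceil>b + \<theta> * real (i + 1)\<rceil> - 1) - \<theta> * real (i + 1) < b" by linarith
      fix p assume "p \<in> P"
      from step[OF this] obtain t where "\<eta> (Suc k) \<le> t" "t \<le> \<eta> k" "p + t \<in> P"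
        using False by (auto simp: g_def)
      then show "\<exists>p'\<in>P. p + \<eta> (Suc k) \<le> p' \<and> p' \<le> p + \<eta> k"
        by (intro bexI) auto
    qed (use err_pos assms in auto)
  qed
  then show ?thesis using that unfolding P_def by blast
qed

text \<open>The points whose itinerary starts with a given factor of length \<open>n\<close> form the half-open
  interval \<open>{a..<b}\<close>; its endpoints lie in the orbit of \<open>0\<close> with index at most \<open>n\<close>.\<close>

lemma factor_recurs:
  assumes n: "n < q (Suc k)"
  obtains m where "i \<le> m" "m < i + q (Suc k) + q k" "factor m n = factor j n"
proof -
  define c where "c l = S (j + l) - S j" for l
  define a where "a = (MAX l\<in>{..n}. real l * \<theta> - of_int (c l))"
  define b where "b = (MIN l\<in>{..n}. real l * \<theta> - of_int (c l) + 1)"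
  \<comment> \<open>The orbit point of index \<open>j\<close> satisfies all the constraints itself,
    which shows \<open>a < b\<close>.\<close>
  define y where "y = of_int (S j) - \<theta> * real (j + 1)"
  have ay: "real l * \<theta> - of_int (c l) \<le> y" "y < real l * \<theta> - of_int (c l) + 1" for l
  proof -
    have "\<theta> * real (j + l + 1) = real l * \<theta> + \<theta> * real (j + 1)" by (simp add: algebra_simps)
    then show "real l * \<theta> - of_int (c l) \<le> y" "y < real l * \<theta> - of_int (c l) + 1"
      unfolding y_def c_def S_def of_int_diff by linarith+
  qed
  have "a \<in> (\<lambda>l. real l * \<theta> - of_int (c l)) ` {..n}" unfolding a_def by (rule Max_in) auto
  then obtain la where la: "la \<le> n" "a = real la * \<theta> - of_int (c la)" by auto
  have "b \<in> (\<lambda>l. real l * \<theta> - of_int (c l) + 1) ` {..n}" unfolding b_def by (rule Min_in) auto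
  then obtain lb where lb: "lb \<le> n" "b = real lb * \<theta> - of_int (c lb) + 1" by auto
  have ab: "a < b" using ay(1)[of la] ay(2)[of lb] la lb by simp
  define u where "u = int lb - int la"
  define N where "N = c lb - c la - 1"
  have ba: "b - a = of_int u * \<theta> - of_int N" by (simp add: la lb u_def N_def algebra_simps)
  \<comment> \<open>\<open>u\<close> is a difference of two indices that are at most
    \<open>n\<close>, and \<open>a < b\<close> excludes \<open>u = N = 0\<close>.\<close>
  have "\<bar>of_int u * \<theta> - of_int N\<bar> \<ge> \<eta> k"
    using ab ba n la lb by (intro best_approximation) (auto simp: u_def)
  then have "b - a \<ge> \<eta> k" using ab ba by simp
  then obtain m M where m: "i \<le> m" "m < i + q (Suc k) + q k"
    and M: "a \<le> of_int M - \<theta> * real (m + 1)" "of_int M - \<theta> * real (m + 1) < b"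
    by (rule orbit_window_hits)
  \<comment> \<open>The point found lies between the maximum \<open>a\<close> and the minimum
    \<open>b\<close>, hence meets the constraint for every \<open>l\<close> at once;
    \<open>l = 0\<close> identifies \<open>M\<close> as \<open>S m\<close>.\<close>
  have Sm: "S (m + l) = M + c l" if "l \<le> n" for l
  proof -
    have "real l * \<theta> - of_int (c l) \<le> a" unfolding a_def using that by (intro Max_ge) auto
    moreover have "b \<le> real l * \<theta> - of_int (c l) + 1" unfolding b_def using that by (intro Min_le) auto
    moreover have "\<theta> * real (m + l + 1) = real l * \<theta> + \<theta> * real (m + 1)" by (simp add: algebra_simps)
    ultimately show ?thesis unfolding S_def using M by (intro ceiling_unique) auto
  qed
  have "c 0 = 0" by (simp add: c_def)
  then have "factor m n = factor j n"
    using Sm[of 0] Sm by (intro factor_eqI) (simp add: c_def)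
  then show ?thesis using that m by blast
qed

lemma factors_occur:
  assumes n: "n < q (Suc k)" and w: "w \<in> language (sturmian_subshift \<theta>)" "length w = n"
    and W: "W \<in> language (sturmian_subshift \<theta>)" "length W \<ge> q (Suc k) + q k + n"
  shows "sublist w W"
proof -
  obtain i where Wi: "W = factor i (length W)" using W(1) by (auto simp: language_sturmian)
  obtain j where wj: "w = factor j n" using w by (auto simp: language_sturmian)
  from factor_recurs[OF n] obtain m where m: "i \<le> m" "m < i + q (Suc k) + q k"
    "factor m n = factor j n" by blast
  have "factor m n = take n (drop (m - i) W)"
    using m W by (subst Wi) (simp add: take_factor drop_factor)
  then have "W = take (m - i) W @ w @ drop n (drop (m - i) W)"
    using m wj by (metis append_take_drop_id)
  then show ?thesis unfolding sublist_def by blast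
qed

end

section \<open>Periods\<close>

text \<open>A word no longer than \<open>d\<close> has period \<open>d\<close> vacuously.\<close>

definition has_period :: "nat \<Rightarrow> 'a list \<Rightarrow> bool" where
  "has_period d W \<longleftrightarrow> (\<forall>i. i + d < length W \<longrightarrow> W ! (i + d) = W ! i)"

lemma has_period_take: "has_period d W \<Longrightarrow> has_period d (take m W)"
  by (simp add: has_period_def)

text \<open>The two occurrences of \<open>w\<close> are offset by the length difference, so
  positions at that distance read the same letter of \<open>w\<close>.\<close>

lemma border_has_period:
  assumes "prefix w W" "suffix w W"
  shows "has_period (length W - length w) W"
  unfolding has_period_def
proof (intro allI impI)
  fix i assume i: "i + (length W - length w) < length W"
  obtain u v where uv: "W = w @ u" "W = v @ w" using assms unfolding prefix_def suffix_def by blast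
  have len: "length W - length w = length v" by (subst uv(2)) simp
  have "i < length w" using i unfolding len by (subst (asm) uv(2)) simp
  then have "W ! (i + length v) = w ! i" "W ! i = w ! i"
    by (subst uv(2), simp add: nth_append, subst uv(1), simp add: nth_append)
  then show "W ! (i + (length W - length w)) = W ! i" by (simp add: len)
qed

lemma period_drop:
  assumes "has_period d W"
  shows "drop d W = take (length W - d) W"
  using assms by (intro nth_equalityI) (auto simp: has_period_def add.commute)

text \<open>One copy of \<open>W\<close> can be split off at either end, so the remaining
  \<open>p\<close> copies form a border.\<close>

lemma power_has_period: "has_period (length W) (concat (replicate (Suc p) W))"
proof -
  let ?X = "concat (replicate p W)"
  have eq: "concat (replicate (Suc p) W) = ?X @ W"
    by (simp flip: replicate_append_same)
  have "has_period (length (W @ ?X) - length ?X) (W @ ?X)"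
    by (rule border_has_period) (use eq in \<open>auto simp: suffix_def intro: exI[of _ W]\<close>)
  then show ?thesis by simp
qed

lemma period_power:
  assumes "has_period n V" "p * n \<le> length V"
  shows "concat (replicate p (take n V)) = take (p * n) V"
  using assms(2)
proof (induction p)
  case (Suc p)
  have "take (Suc p * n) V = take n V @ take (p * n) (drop n V)"
    by (simp add: take_add)
  also have "take (p * n) (drop n V) = take (p * n) V"
    using Suc.prems by (simp add: period_drop[OF assms(1)] min_absorb1)
  finally show ?case using Suc by simp
qed simp

text \<open>Sliding the window by one place drops \<open>W ! i\<close> and gains
  \<open>W ! (i + n)\<close>, which are equal.\<close>

lemma period_sum_list:
  fixes W :: "int list"
  assumes "has_period n W" "i + n \<le> length W"
  shows "sum_list (take n (drop i W)) = sum_list (take n W)"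
  using assms(2)
proof (induction i)
  case (Suc i)
  show ?case
  proof (cases n)
    case (Suc n')
    have "drop i W = W ! i # drop (Suc i) W"
      using Suc.prems by (simp add: Cons_nth_drop_Suc)
    then have "sum_list (take n (drop i W)) = W ! i + sum_list (take n' (drop (Suc i) W))"
      by (simp add: Suc)
    moreover have "take n (drop (Suc i) W) = take n' (drop (Suc i) W) @ [W ! (i + n)]"
      using Suc.prems by (simp add: Suc take_Suc_conv_app_nth)
    moreover have "W ! (i + n) = W ! i" using assms(1) Suc.prems by (simp add: has_period_def)
    ultimately show ?thesis using Suc.IH Suc.prems by simp
  qed simp
qed simp

lemma period_sum_sublist:
  fixes W :: "int list"
  assumes "has_period n W" "sublist w W" "length w = n"
  shows "sum_list w = sum_list (take n W)"
proof -
  obtain u v where W: "W = u @ w @ v" using assms(2) by (auto simp: sublist_def)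
  then have "w = take n (drop (length u) W)" using assms(3) by simp
  then show ?thesis using period_sum_list[OF assms(1), of "length u"] assms(3) W by simp
qed

context irrational_slope
begin

lemma period_not_all_factors:
  assumes "n \<ge> 1" "has_period n W"
  obtains w where "w \<in> language (sturmian_subshift \<theta>)" "length w = n" "\<not> sublist w W"
proof -
  obtain i j where ij: "sum_list (factor i n) \<noteq> sum_list (factor j n)"
    using factor_sums_vary[OF assms(1)] .
  have "factor l n \<in> language (sturmian_subshift \<theta>)" for l
    by (auto simp: language_sturmian)
  moreover have "\<not> sublist (factor i n) W \<or> \<not> sublist (factor j n) W"
    using ij period_sum_sublist[OF assms(2), of "factor i n"]
      period_sum_sublist[OF assms(2), of "factor j n"] by auto
  ultimately show ?thesis using that[of "factor i n"] that[of "factor j n"] by auto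
qed

text \<open>At length \<open>q (Suc k) + q k + n\<close> all words of length \<open>n\<close> would
  occur, which period \<open>n\<close> forbids. The constant 3 bounds all three summands by
  \<open>q (Suc k)\<close>.\<close>

lemma period_bound:
  assumes "1 \<le> n" "n < q (Suc k)" "W \<in> language (sturmian_subshift \<theta>)" "has_period n W"
  shows "length W < 3 * q (Suc k)"
proof (rule ccontr)
  assume "\<not> ?thesis"
  then have "length W \<ge> q (Suc k) + q k + n" using denom_mono_Suc[of k] assms(2) by linarith
  moreover obtain w where "w \<in> language (sturmian_subshift \<theta>)" "length w = n" "\<not> sublist w W"
    using period_not_all_factors[OF assms(1,4)] .
  ultimately show False using factors_occur[OF assms(2) _ _ assms(3)] by blast
qed

lemma long_periodic_factor:
  obtains V where "V \<in> language (sturmian_subshift \<theta>)" "length V = q (Suc k) + q k - 2"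
    "has_period (q k) V"
proof
  show "factor 0 (q (Suc k) + q k - 2) \<in> language (sturmian_subshift \<theta>)"
    by (auto simp: language_sturmian)
  show "has_period (q k) (factor 0 (q (Suc k) + q k - 2))"
    unfolding has_period_def using factor_periodic[of _ k] by simp
qed simp

section \<open>Estimates for the complexity functions\<close>

lemma repetitivity_upper:
  assumes "n < q (Suc k)"
  shows "repetitivity (sturmian_subshift \<theta>) n \<le> enat (3 * q (Suc k))"
proof -
  have "repetitivity (sturmian_subshift \<theta>) n \<le> enat (q (Suc k) + q k + n)"
    unfolding repetitivity_def using factors_occur[OF assms] by (intro INF_lower) auto
  also have "\<dots> \<le> enat (3 * q (Suc k))" using assms denom_mono_Suc[of k] by simp
  finally show ?thesis .
qed

text \<open>Every prefix of the long word of period \<open>q k\<close> inherits the period and so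
  misses a word of length \<open>q k\<close>. An admissible \<open>r\<close> must exceed the length
  of that long word.\<close>

lemma repetitivity_lower:
  "repetitivity (sturmian_subshift \<theta>) (q k) \<ge> enat (q (Suc k) + q k - 1)"
  unfolding repetitivity_def
proof (rule INF_greatest)
  fix r assume r: "r \<in> {r'. \<forall>W \<in> language (sturmian_subshift \<theta>). length W = r' \<longrightarrow>
     (\<forall>w \<in> language (sturmian_subshift \<theta>). length w = q k \<longrightarrow> sublist w W)}"
  obtain V where V: "V \<in> language (sturmian_subshift \<theta>)" "length V = q (Suc k) + q k - 2"
    "has_period (q k) V" by (rule long_periodic_factor)
  have "\<not> r \<le> length V"
  proof
    assume le: "r \<le> length V"
    obtain w where w: "w \<in> language (sturmian_subshift \<theta>)" "length w = q k" "\<not> sublist w (take r V)"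
      using period_not_all_factors[OF denom_pos has_period_take[OF V(3)]] .
    moreover have "length (take r V) = r" using le by simp
    ultimately have "sublist w (take r V)"
      using r[unfolded mem_Collect_eq, rule_format, OF take_in_language[OF V(1)]] w(1,2) by simp
    then show False using w(3) by simp
  qed
  then have "q (Suc k) + q k - 1 \<le> r" using V(2) by linarith
  then show "enat (q (Suc k) + q k - 1) \<le> enat r" by simp
qed

text \<open>A power of a word of length \<open>n\<close> has period \<open>n\<close>, so
  \<open>period_bound\<close> limits its total length \<open>p * n\<close>.\<close>

lemma max_power_upper:
  assumes n: "1 \<le> n" "n < q (Suc k)"
  shows "max_power (sturmian_subshift \<theta>) n \<le> enat (3 * q (Suc k) div n)"
  unfolding max_power_def
proof (rule SUP_least)
  fix p assume "p \<in> {p. p \<ge> 1 \<and> (\<exists>W \<in> language (sturmian_subshift \<theta>). length W = n \<and>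
    concat (replicate p W) \<in> language (sturmian_subshift \<theta>))}"
  then obtain W where W: "p \<ge> 1" "length W = n"
    "concat (replicate p W) \<in> language (sturmian_subshift \<theta>)"
    unfolding mem_Collect_eq by (elim conjE bexE)
  have "has_period n (concat (replicate p W))"
    using power_has_period[of W "p - 1"] W by simp
  from period_bound[OF n W(3) this] have "p * n < 3 * q (Suc k)"
    using W by (simp add: length_concat sum_list_replicate)
  then have "p \<le> 3 * q (Suc k) div n" using n by (simp add: less_eq_div_iff_mult_less_eq)
  then show "enat p \<le> enat (3 * q (Suc k) div n)" by simp
qed

text \<open>The long word of period \<open>q k\<close> is cut into blocks of length
  \<open>q k\<close>; \<open>q k \<ge> 2\<close> ensures that it has length at least
  \<open>q (Suc k)\<close>.\<close>

lemma max_power_lower: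
  assumes "q k \<ge> 2"
  shows "max_power (sturmian_subshift \<theta>) (q k) \<ge> enat (q (Suc k) div q k)"
proof -
  obtain V where V: "V \<in> language (sturmian_subshift \<theta>)" "length V = q (Suc k) + q k - 2"
    "has_period (q k) V" by (rule long_periodic_factor)
  have "q (Suc k) div q k * q k \<le> q (Suc k)" by simp
  also have "\<dots> \<le> length V" using V assms by simp
  finally have le: "q (Suc k) div q k * q k \<le> length V" .
  have "concat (replicate (q (Suc k) div q k) (take (q k) V)) \<in> language (sturmian_subshift \<theta>)"
    using take_in_language[OF V(1)] by (simp add: period_power[OF V(3) le])
  moreover have "length (take (q k) V) = q k" using V assms denom_mono_Suc[of k] by simp
  moreover have "q (Suc k) div q k \<ge> 1"
    using denom_mono_Suc[of k] denom_pos[of k] by (simp add: Suc_le_eq div_greater_zero_iff)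
  ultimately show ?thesis unfolding max_power_def
    using take_in_language[OF V(1)] by (intro SUP_upper) blast
qed

text \<open>The index \<open>k\<close> comes from bracketing the period
  \<open>length W - length w\<close> between consecutive denominators; the length of
  \<open>W\<close> is then limited by \<open>period_bound\<close>.\<close>

lemma border_bounds:
  assumes "W \<in> language (sturmian_subshift \<theta>)" "prefix w W" "suffix w W" "W \<noteq> w" "w \<noteq> []"
  obtains k where "real (q k) \<le> real (length W) - real (length w)" "length W < 3 * q (Suc k)"
proof -
  have lt: "length w < length W"
    using assms(2,4) by (simp add: prefix_length_less strict_prefix_def)
  then have "length W - length w \<ge> 1" by simp
  then obtain k where k: "q k \<le> length W - length w" "length W - length w < q (Suc k)"
    by (rule denom_bracket)
  have "length W < 3 * q (Suc k)"
    using lt k border_has_period[OF assms(2,3)] by (intro period_bound[OF _ _ assms(1)]) auto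
  moreover have "real (q k) \<le> real (length W) - real (length w)" using k(1) lt by linarith
  ultimately show ?thesis using that by blast
qed

text \<open>Removing \<open>q k\<close> letters from either end of the long word of period
  \<open>q k\<close> leaves the same word, and this border is the witness for the infimum.\<close>

lemma repulsion_upper:
  assumes "q (Suc k) \<ge> 4" "\<alpha> > 0"
  shows "repulsion \<alpha> (sturmian_subshift \<theta>) (q (Suc k) + q k - 2)
    \<le> ereal (real (q k) / (real (q (Suc k)) / 2) powr (1 / \<alpha>))"
proof -
  obtain V where V: "V \<in> language (sturmian_subshift \<theta>)" "length V = q (Suc k) + q k - 2"
    "has_period (q k) V" by (rule long_periodic_factor)
  define w where "w = take (length V - q k) V"
  have qk: "1 \<le> q k" by (rule denom_pos)
  have lw: "length w = q (Suc k) - 2" using V by (simp add: w_def)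
  have dr: "drop (q k) V = w" using period_drop[OF V(3)] by (simp add: w_def)
  have "repulsion \<alpha> (sturmian_subshift \<theta>) (q (Suc k) + q k - 2)
    \<le> ereal ((real (length V) - real (length w)) / real (length w) powr (1 / \<alpha>))"
    unfolding repulsion_def
  proof (intro Inf_lower CollectI exI conjI)
    show "prefix w V" by (simp add: w_def take_is_prefix)
    show "suffix w V" unfolding dr[symmetric] by (rule suffix_drop)
    show "w \<in> language (sturmian_subshift \<theta>)" unfolding w_def by (rule take_in_language[OF V(1)])
    show "w \<noteq> []" using lw assms by auto
    show "V \<noteq> w" using lw V qk assms by auto
  qed (use V in auto)
  also have "real (length V) - real (length w) = real (q k)"
    using lw V assms qk by (simp add: of_nat_diff)
  \<comment> \<open>The border has length \<open>q (Suc k) - 2\<close>, which is at least half of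
    \<open>q (Suc k)\<close> because \<open>q (Suc k) \<ge> 4\<close>.\<close>
  also have "real (q k) / real (length w) powr (1 / \<alpha>) \<le> real (q k) / (real (q (Suc k)) / 2) powr (1 / \<alpha>)"
    using lw assms by (intro divide_left_mono powr_mono2 mult_pos_pos) (auto simp: of_nat_diff)
  finally show ?thesis by simp
qed

end

section \<open>Finite and positive upper and lower limits\<close>

text \<open>This and the next three lemmas trade upper and lower limits for positive real bounds,
  into which constant factors can be absorbed.\<close>

lemma limsup_finite_iff:
  fixes f :: "nat \<Rightarrow> ereal"
  shows "limsup f < \<infinity> \<longleftrightarrow> (\<exists>B>0. \<exists>N. \<forall>n\<ge>N. f n \<le> ereal B)"
proof
  assume "limsup f < \<infinity>"
  then obtain B where B: "limsup f < ereal B" using ereal_dense2 by blast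
  then have "eventually (\<lambda>n. f n < ereal B) sequentially" by (rule Limsup_lessD)
  then obtain N where "\<forall>n\<ge>N. f n < ereal B" by (auto simp: eventually_sequentially)
  moreover have "ereal B \<le> ereal (max B 1)" by simp
  ultimately have "\<forall>n\<ge>N. f n \<le> ereal (max B 1)" by (meson less_imp_le order.trans)
  then show "\<exists>B>0. \<exists>N. \<forall>n\<ge>N. f n \<le> ereal B" by (intro exI[of _ "max B 1"]) auto
next
  assume "\<exists>B>0. \<exists>N. \<forall>n\<ge>N. f n \<le> ereal B"
  then obtain B where "eventually (\<lambda>n. f n \<le> ereal B) sequentially"
    by (auto simp: eventually_sequentially)
  then have "limsup f \<le> ereal B" by (rule Limsup_bounded)
  then show "limsup f < \<infinity>" by auto
qed

lemma limsup_positive_iff: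
  fixes f :: "nat \<Rightarrow> ereal"
  shows "0 < limsup f \<longleftrightarrow> (\<exists>e>0. \<forall>N. \<exists>n\<ge>N. ereal e \<le> f n)"
proof
  assume "0 < limsup f"
  then obtain e where e: "0 < ereal e" "ereal e < limsup f" using ereal_dense2 by blast
  have "\<exists>n\<ge>N. ereal e \<le> f n" for N
  proof (rule ccontr)
    assume none: "\<not> ?thesis"
    have "f n \<le> ereal e" if "n \<ge> N" for n
      using none that by (cases "ereal e \<le> f n") auto
    then have "eventually (\<lambda>n. f n \<le> ereal e) sequentially"
      unfolding eventually_sequentially by blast
    then have "limsup f \<le> ereal e" by (rule Limsup_bounded)
    then show False using e by simp
  qed
  then show "\<exists>e>0. \<forall>N. \<exists>n\<ge>N. ereal e \<le> f n" using e by auto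
next
  assume "\<exists>e>0. \<forall>N. \<exists>n\<ge>N. ereal e \<le> f n"
  then obtain e where e: "e > 0" "\<And>N. \<exists>n\<ge>N. ereal e \<le> f n" by blast
  show "0 < limsup f"
  proof (rule ccontr)
    assume "\<not> 0 < limsup f"
    then have "limsup f < ereal e" using e(1) by (auto simp: not_less intro: le_less_trans)
    then have "eventually (\<lambda>n. f n < ereal e) sequentially" by (rule Limsup_lessD)
    then show False using e(2) by (force simp: eventually_sequentially)
  qed
qed

lemma liminf_positive_iff:
  fixes f :: "nat \<Rightarrow> ereal"
  shows "0 < liminf f \<longleftrightarrow> (\<exists>e>0. \<exists>N. \<forall>n\<ge>N. ereal e \<le> f n)"
proof
  assume "0 < liminf f"
  then obtain e where e: "0 < ereal e" "ereal e < liminf f" using ereal_dense2 by blast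
  then have "eventually (\<lambda>n. ereal e < f n) sequentially" using less_LiminfD by blast
  then show "\<exists>e>0. \<exists>N. \<forall>n\<ge>N. ereal e \<le> f n"
    using e by (force simp: eventually_sequentially)
next
  assume "\<exists>e>0. \<exists>N. \<forall>n\<ge>N. ereal e \<le> f n"
  then obtain e where e: "e > 0" "eventually (\<lambda>n. ereal e \<le> f n) sequentially"
    by (auto simp: eventually_sequentially)
  from e(2) have "ereal e \<le> liminf f" by (rule Liminf_bounded)
  then show "0 < liminf f" using e(1) by (metis ereal_less(2) less_le_trans)
qed

lemma liminf_finite_iff:
  fixes f :: "nat \<Rightarrow> ereal"
  shows "liminf f < \<infinity> \<longleftrightarrow> (\<exists>B>0. \<forall>N. \<exists>n\<ge>N. f n < ereal B)"
proof
  assume "liminf f < \<infinity>"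
  then obtain B where B: "liminf f < ereal B" using ereal_dense2 by blast
  have "\<exists>n\<ge>N. f n < ereal (max B 1)" for N
  proof (rule ccontr)
    assume "\<not> ?thesis"
    then have "eventually (\<lambda>n. ereal (max B 1) \<le> f n) sequentially"
      by (auto simp: eventually_sequentially not_less intro!: exI[of _ N])
    then have "ereal (max B 1) \<le> liminf f" by (rule Liminf_bounded)
    moreover have "ereal B \<le> ereal (max B 1)" by simp
    ultimately show False using B by (meson leD order.trans)
  qed
  then show "\<exists>B>0. \<forall>N. \<exists>n\<ge>N. f n < ereal B" by (intro exI[of _ "max B 1"]) auto
next
  assume "\<exists>B>0. \<forall>N. \<exists>n\<ge>N. f n < ereal B"
  then obtain B where B: "\<And>N. \<exists>n\<ge>N. f n < ereal B" by blast
  show "liminf f < \<infinity>"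
  proof (rule ccontr)
    assume "\<not> ?thesis"
    then have "ereal B < liminf f" by (simp add: not_less top_ereal_def)
    then have "eventually (\<lambda>n. ereal B < f n) sequentially" using less_LiminfD by blast
    then show False using B by (force simp: eventually_sequentially)
  qed
qed

section \<open>Extended-real quotients and real powers\<close>

lemma ereal_finite_nonzero_iff:
  fixes x :: ereal
  assumes "0 \<le> x"
  shows "\<bar>x\<bar> \<noteq> \<infinity> \<and> x \<noteq> 0 \<longleftrightarrow> 0 < x \<and> x < \<infinity>"
  using assms by (cases x) auto

lemma ereal_of_enat_divide_le:
  assumes "x \<le> enat a" "b > 0"
  shows "ereal_of_enat x / ereal b \<le> ereal (real a / b)"
proof -
  have "ereal_of_enat x \<le> ereal_of_enat (enat a)" using assms(1) by (simp only: ereal_of_enat_le_iff)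
  then have "ereal_of_enat x / ereal b \<le> ereal (real a) / ereal b"
    using assms(2) by (intro ereal_divide_right_mono) auto
  then show ?thesis using assms(2) by simp
qed

lemma ereal_of_enat_divide_ge:
  assumes "enat a \<le> x" "b > 0"
  shows "ereal (real a / b) \<le> ereal_of_enat x / ereal b"
proof -
  have "ereal_of_enat (enat a) \<le> ereal_of_enat x" using assms(1) by (simp only: ereal_of_enat_le_iff)
  then have "ereal (real a) / ereal b \<le> ereal_of_enat x / ereal b"
    using assms(2) by (intro ereal_divide_right_mono) auto
  then show ?thesis using assms(2) by simp
qed

lemma limsup_enat_ratio_nonneg: "0 \<le> limsup (\<lambda>n. ereal_of_enat (g n) / ereal (real n powr b))"
proof (rule le_Limsup)
  show "eventually (\<lambda>n. 0 \<le> ereal_of_enat (g n) / ereal (real n powr b)) sequentially"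
    unfolding eventually_sequentially
  \<comment> \<open>Starting at 1 keeps the denominator positive, since
    \<open>0 powr b = 0\<close>.\<close>
  proof (intro exI[of _ 1] allI impI)
    fix n :: nat assume "1 \<le> n"
    then show "0 \<le> ereal_of_enat (g n) / ereal (real n powr b)"
      using ereal_of_enat_divide_ge[of 0 "g n" "real n powr b"] by (simp add: zero_enat_def[symmetric])
  qed
qed simp

text \<open>The two powers are mutually inverse decreasing functions on the positive reals.\<close>

lemma powr_minus_inverse_le_iff:
  fixes x y a :: real
  assumes "x > 0" "y > 0" "a > 0"
  shows "x powr (- (1 / a)) \<le> y \<longleftrightarrow> y powr (- a) \<le> x"
proof
  have x: "(x powr (- (1 / a))) powr (- a) = x" and y: "(y powr (- a)) powr (- (1 / a)) = y"
    using assms by (simp_all add: powr_powr)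
  show "x powr (- (1 / a)) \<le> y \<Longrightarrow> y powr (- a) \<le> x"
    using powr_mono2'[of "- a" "x powr (- (1 / a))" y] assms by (simp add: x)
  show "y powr (- a) \<le> x \<Longrightarrow> x powr (- (1 / a)) \<le> y"
    using powr_mono2'[of "- (1 / a)" "y powr (- a)" x] assms by (simp add: y)
qed

text \<open>This writes a repulsion quotient as a decreasing function of a growth ratio of the shape
  of \<open>denom_ratio\<close>.\<close>

lemma divide_powr_inverse_eq:
  fixes b c a :: real
  assumes "b > 0" "c > 0" "a > 0"
  shows "b / c powr (1 / a) = (c / b powr a) powr (- (1 / a))"
  using assms by (simp add: powr_divide powr_powr powr_minus)

section \<open>The common growth condition\<close>

context irrational_slope
begin

definition denom_ratio :: "real \<Rightarrow> nat \<Rightarrow> real" where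
  "denom_ratio \<alpha> k = real (q (Suc k)) / real (q k) powr \<alpha>"

text \<open>Together with \<open>ratio_nonvanishing\<close> this spells out, over the reals, that
  the upper limit of \<open>denom_ratio\<close> is finite and positive.\<close>

definition ratio_bounded :: "real \<Rightarrow> bool" where
  "ratio_bounded \<alpha> \<longleftrightarrow> (\<exists>B>0. \<exists>K. \<forall>k\<ge>K. denom_ratio \<alpha> k \<le> B)"

definition ratio_nonvanishing :: "real \<Rightarrow> bool" where
  "ratio_nonvanishing \<alpha> \<longleftrightarrow> (\<exists>e>0. \<forall>K. \<exists>k\<ge>K. e \<le> denom_ratio \<alpha> k)"

lemma denom_ratio_pos: "denom_ratio \<alpha> k > 0"
  using denom_pos[of k] denom_pos[of "Suc k"] by (simp add: denom_ratio_def)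

text \<open>The upper estimate carries boundedness from the ratios to \<open>f\<close> and
  positivity from \<open>f\<close> to the ratios; the lower estimate along \<open>m\<close> carries
  both the other way. \<open>k \<le> m k\<close> makes the sampled indices pass every
  \<open>N\<close>.\<close>

lemma limsup_comparison:
  fixes f :: "nat \<Rightarrow> ereal"
  assumes "C > 0" "c > 0"
    and upper: "\<And>K. \<exists>N. \<forall>n\<ge>N. \<exists>k\<ge>K. f n \<le> ereal (C * denom_ratio \<alpha> k)"
    and lower: "\<exists>K. \<forall>k\<ge>K. ereal (c * denom_ratio \<alpha> k) \<le> f (m k)"
    and m: "\<And>k. k \<le> m k"
  shows "0 < limsup f \<and> limsup f < \<infinity> \<longleftrightarrow> ratio_bounded \<alpha> \<and> ratio_nonvanishing \<alpha>"
proof -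
  obtain K0 where low: "\<And>k. k \<ge> K0 \<Longrightarrow> ereal (c * denom_ratio \<alpha> k) \<le> f (m k)"
    using lower by blast
  have "limsup f < \<infinity> \<longleftrightarrow> ratio_bounded \<alpha>"
  proof
    assume "limsup f < \<infinity>"
    then obtain B N where B: "B > 0" "\<And>n. n \<ge> N \<Longrightarrow> f n \<le> ereal B"
      unfolding limsup_finite_iff by blast
    have "denom_ratio \<alpha> k \<le> B / c" if "k \<ge> max K0 N" for k
    proof -
      have "ereal (c * denom_ratio \<alpha> k) \<le> ereal B"
        using low[of k] B(2)[of "m k"] m[of k] that by (meson max.boundedE order.trans)
      then show ?thesis using assms(2) by (simp add: field_simps)
    qed
    moreover have "B / c > 0" using B(1) assms(2) by simp
    ultimately show "ratio_bounded \<alpha>" unfolding ratio_bounded_def by blast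
  next
    assume "ratio_bounded \<alpha>"
    then obtain B K where B: "B > 0" "\<And>k. k \<ge> K \<Longrightarrow> denom_ratio \<alpha> k \<le> B"
      unfolding ratio_bounded_def by blast
    obtain N where N: "\<And>n. n \<ge> N \<Longrightarrow> \<exists>k\<ge>K. f n \<le> ereal (C * denom_ratio \<alpha> k)"
      using upper by blast
    have "f n \<le> ereal (C * B)" if n: "n \<ge> N" for n
    proof -
      obtain k where k: "k \<ge> K" "f n \<le> ereal (C * denom_ratio \<alpha> k)" using N[OF n] by blast
      have "C * denom_ratio \<alpha> k \<le> C * B" using B(2)[OF k(1)] assms(1) by simp
      then show ?thesis using k(2) by (meson ereal_less_eq(3) order.trans)
    qed
    then show "limsup f < \<infinity>" unfolding limsup_finite_iff
      using B(1) assms(1) by (intro exI[of _ "C * B"]) auto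
  qed
  moreover have "0 < limsup f \<longleftrightarrow> ratio_nonvanishing \<alpha>"
  proof
    assume "0 < limsup f"
    then obtain e where e: "e > 0" "\<And>N. \<exists>n\<ge>N. ereal e \<le> f n"
      unfolding limsup_positive_iff by blast
    have "\<exists>k\<ge>K. e / C \<le> denom_ratio \<alpha> k" for K
    proof -
      obtain N where "\<And>n. n \<ge> N \<Longrightarrow> \<exists>k\<ge>K. f n \<le> ereal (C * denom_ratio \<alpha> k)"
        using upper by blast
      then obtain k where k: "k \<ge> K" "ereal e \<le> ereal (C * denom_ratio \<alpha> k)"
        using e(2)[of N] by (meson order.trans)
      then show ?thesis using assms(1) by (intro exI[of _ k]) (simp add: field_simps)
    qed
    then show "ratio_nonvanishing \<alpha>" unfolding ratio_nonvanishing_def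
      using e(1) assms(1) by (intro exI[of _ "e / C"]) auto
  next
    assume "ratio_nonvanishing \<alpha>"
    then obtain e where e: "e > 0" "\<And>K. \<exists>k\<ge>K. e \<le> denom_ratio \<alpha> k"
      unfolding ratio_nonvanishing_def by blast
    have "\<exists>n\<ge>N. ereal (c * e) \<le> f n" for N
    proof -
      obtain k where k: "k \<ge> max K0 N" "e \<le> denom_ratio \<alpha> k" using e(2) by blast
      have "ereal (c * e) \<le> ereal (c * denom_ratio \<alpha> k)" using k(2) assms(2) by simp
      also have "\<dots> \<le> f (m k)" using low k(1) by simp
      finally show ?thesis using k(1) m[of k] by (intro exI[of _ "m k"]) auto
    qed
    then show "0 < limsup f" unfolding limsup_positive_iff
      using e(1) assms(2) by (intro exI[of _ "c * e"]) auto
  qed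
  ultimately show ?thesis by blast
qed

lemma bracket_eventually_large:
  "\<exists>N. \<forall>n\<ge>N. \<forall>k. n < q (Suc k) \<longrightarrow> K \<le> k"
proof (intro exI[of _ "q K"] allI impI)
  fix n k assume "q K \<le> n" "n < q (Suc k)"
  then show "K \<le> k" using denom_mono[of "Suc k" K] by (cases "Suc k \<le> K") auto
qed

text \<open>Within a bracket the estimate is worst at its left end \<open>n = q k\<close>, where it
  becomes a multiple of \<open>denom_ratio\<close>; the lower estimate is sampled at the same
  points.\<close>

lemma limsup_comparison_bracket:
  fixes f :: "nat \<Rightarrow> ereal"
  assumes "C > 0" "c > 0"
    and upper: "\<And>n k. 1 \<le> n \<Longrightarrow> q k \<le> n \<Longrightarrow> n < q (Suc k) \<Longrightarrow>
      f n \<le> ereal (C * (real (q (Suc k)) / real n powr \<alpha>))"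
    and lower: "\<And>k. k \<ge> 2 \<Longrightarrow> ereal (c * denom_ratio \<alpha> k) \<le> f (q k)"
    and "\<alpha> > 0"
  shows "0 < limsup f \<and> limsup f < \<infinity> \<longleftrightarrow> ratio_bounded \<alpha> \<and> ratio_nonvanishing \<alpha>"
proof (rule limsup_comparison[OF assms(1,2)])
  fix K
  obtain N where N: "\<And>n k. n \<ge> N \<Longrightarrow> n < q (Suc k) \<Longrightarrow> K \<le> k"
    using bracket_eventually_large by blast
  have "\<exists>k\<ge>K. f n \<le> ereal (C * denom_ratio \<alpha> k)" if "n \<ge> max N 1" for n
  proof -
    have n: "1 \<le> n" using that by simp
    obtain k where k: "q k \<le> n" "n < q (Suc k)" using denom_bracket[OF n] .
    have "f n \<le> ereal (C * (real (q (Suc k)) / real n powr \<alpha>))" by (rule upper[OF n k])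
    also have "C * (real (q (Suc k)) / real n powr \<alpha>) \<le> C * denom_ratio \<alpha> k"
      unfolding denom_ratio_def using k denom_pos[of k] n assms(1,5)
      by (intro mult_left_mono divide_left_mono powr_mono2 mult_pos_pos) auto
    finally show ?thesis using N k that by auto
  qed
  then show "\<exists>N. \<forall>n\<ge>N. \<exists>k\<ge>K. f n \<le> ereal (C * denom_ratio \<alpha> k)" by blast
  show "\<exists>K. \<forall>k\<ge>K. ereal (c * denom_ratio \<alpha> k) \<le> f (q k)" using lower by blast
qed (rule denom_ge_self)

section \<open>The four properties and the growth condition\<close>

lemma repetitive_iff:
  assumes "\<alpha> > 0"
  shows "repetitive \<alpha> (sturmian_subshift \<theta>) \<longleftrightarrow> ratio_bounded \<alpha> \<and> ratio_nonvanishing \<alpha>"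
  unfolding repetitive_def repetitive_limsup_def
    ereal_finite_nonzero_iff[OF limsup_enat_ratio_nonneg]
proof (rule limsup_comparison_bracket[where C = 3 and c = 1])
  fix n k :: nat assume n: "1 \<le> n" "n < q (Suc k)"
  show "ereal_of_enat (repetitivity (sturmian_subshift \<theta>) n) / ereal (real n powr \<alpha>)
    \<le> ereal (3 * (real (q (Suc k)) / real n powr \<alpha>))"
    using ereal_of_enat_divide_le[OF repetitivity_upper[OF n(2)], of "real n powr \<alpha>"] n by simp
next
  fix k
  have "ereal (1 * denom_ratio \<alpha> k) \<le> ereal (real (q (Suc k) + q k - 1) / real (q k) powr \<alpha>)"
    unfolding denom_ratio_def using denom_pos[of k] by (auto intro!: divide_right_mono)
  also have "\<dots> \<le> ereal_of_enat (repetitivity (sturmian_subshift \<theta>) (q k)) / ereal (real (q k) powr \<alpha>)"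
    using denom_pos[of k] by (intro ereal_of_enat_divide_ge repetitivity_lower) auto
  finally show "ereal (1 * denom_ratio \<alpha> k)
    \<le> ereal_of_enat (repetitivity (sturmian_subshift \<theta>) (q k)) / ereal (real (q k) powr \<alpha>)" .
qed (use assms in auto)

lemma power_finite_iff:
  assumes "\<alpha> > 0"
  shows "power_finite \<alpha> (sturmian_subshift \<theta>) \<longleftrightarrow> ratio_bounded \<alpha> \<and> ratio_nonvanishing \<alpha>"
  unfolding power_finite_def finite_limsup_def
    ereal_finite_nonzero_iff[OF limsup_enat_ratio_nonneg]
proof (rule limsup_comparison_bracket[where C = 3 and c = "1 / 2"])
  have split: "real n powr \<alpha> = real n * real n powr (\<alpha> - 1)" if "1 \<le> n" for n
    using that by (simp add: powr_diff)
  fix n k :: nat assume n: "1 \<le> n" "n < q (Suc k)"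
  have "ereal_of_enat (max_power (sturmian_subshift \<theta>) n) / ereal (real n powr (\<alpha> - 1))
    \<le> ereal (real (3 * q (Suc k) div n) / real n powr (\<alpha> - 1))"
    using n by (intro ereal_of_enat_divide_le max_power_upper) auto
  also have "real (3 * q (Suc k) div n) / real n powr (\<alpha> - 1)
    \<le> (real (3 * q (Suc k)) / real n) / real n powr (\<alpha> - 1)"
    using of_nat_div_le_of_nat[of "3 * q (Suc k)" n, where ?'a = real] by (intro divide_right_mono) auto
  also have "\<dots> = 3 * (real (q (Suc k)) / real n powr \<alpha>)" using split[OF n(1)] by simp
  finally show "ereal_of_enat (max_power (sturmian_subshift \<theta>) n) / ereal (real n powr (\<alpha> - 1))
    \<le> ereal (3 * (real (q (Suc k)) / real n powr \<alpha>))" by simp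
next
  fix k :: nat assume "k \<ge> 2"
  then have qk: "q k \<ge> 2" using denom_ge_self[of k] by simp
  \<comment> \<open>Since \<open>d \<ge> 1\<close>, rounding the quotient down loses at most a
    factor 2, hence the constant \<open>1 / 2\<close>.\<close>
  define d where "d = q (Suc k) div q k"
  have "d \<ge> 1" unfolding d_def
    using denom_mono_Suc[of k] qk by (simp add: Suc_le_eq div_greater_zero_iff)
  then have "1 * q k \<le> d * q k" by (intro mult_right_mono) auto
  moreover have "q (Suc k) < d * q k + q k"
    using div_mult_mod_eq[of "q (Suc k)" "q k"] mod_less_divisor[of "q k" "q (Suc k)"] qk
    unfolding d_def by linarith
  ultimately have "q (Suc k) \<le> 2 * (d * q k)" by linarith
  then have "real (q (Suc k)) \<le> 2 * (real d * real (q k))"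
    by (metis of_nat_le_iff of_nat_mult of_nat_numeral)
  then have "1 / 2 * denom_ratio \<alpha> k \<le> (real d * real (q k)) / real (q k) powr \<alpha>"
    using divide_right_mono[of "real (q (Suc k)) / 2" "real d * real (q k)" "real (q k) powr \<alpha>"]
    by (simp add: denom_ratio_def)
  also have "\<dots> = real d / real (q k) powr (\<alpha> - 1)"
    using qk by (simp add: powr_diff)
  finally have "ereal (1 / 2 * denom_ratio \<alpha> k) \<le> ereal (real d / real (q k) powr (\<alpha> - 1))" by simp
  also have "\<dots> \<le> ereal_of_enat (max_power (sturmian_subshift \<theta>) (q k)) / ereal (real (q k) powr (\<alpha> - 1))"
    unfolding d_def using qk by (intro ereal_of_enat_divide_ge max_power_lower) auto
  finally show "ereal (1 / 2 * denom_ratio \<alpha> k)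
    \<le> ereal_of_enat (max_power (sturmian_subshift \<theta>) (q k)) / ereal (real (q k) powr (\<alpha> - 1))" .
qed (use assms in auto)

text \<open>The product of \<open>cf_digit \<theta> (Suc k)\<close> and \<open>q k\<close> agrees
  with \<open>q (Suc k)\<close> up to a factor 2. The sampling map is \<open>Suc\<close> because
  digit \<open>n\<close> is paired with \<open>q (n - 1)\<close>.\<close>

lemma well_approximable_iff:
  "well_approximable \<alpha> \<theta> \<longleftrightarrow> ratio_bounded \<alpha> \<and> ratio_nonvanishing \<alpha>"
  unfolding well_approximable_def approx_limsup_def
proof (rule limsup_comparison[where C = 1 and c = "1 / 2" and m = Suc])
  have split: "real a * real (q k) powr (1 - \<alpha>) = real (a * q k) / real (q k) powr \<alpha>" for a k
    using denom_pos[of k] by (simp add: powr_diff)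
  have digit: "cf_digit \<theta> (Suc k) * q k \<le> q (Suc k) \<and> q (Suc k) \<le> 2 * (cf_digit \<theta> (Suc k) * q k)" for k
  proof (cases k)
    case (Suc l)
    have "1 * q k \<le> cf_digit \<theta> (Suc k) * q k"
      using digit_pos by (intro mult_right_mono) auto
    moreover have "q (Suc k) = cf_digit \<theta> (Suc k) * q k + q l" by (simp add: \<open>k = Suc l\<close> cf_denom.simps(3))
    moreover have "q l \<le> q k" using Suc denom_mono_Suc[of l] by simp
    ultimately show ?thesis by (intro conjI; linarith)
  qed simp
  show "\<exists>K. \<forall>k\<ge>K. ereal (1 / 2 * denom_ratio \<alpha> k)
    \<le> ereal (real (cf_digit \<theta> (Suc k)) * real (q (Suc k - 1)) powr (1 - \<alpha>))"
  proof (intro exI allI impI)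
    fix k
    have "real (q (Suc k)) \<le> 2 * real (cf_digit \<theta> (Suc k) * q k)"
      using digit[of k] by (metis of_nat_le_iff of_nat_mult of_nat_numeral)
    then show "ereal (1 / 2 * denom_ratio \<alpha> k)
      \<le> ereal (real (cf_digit \<theta> (Suc k)) * real (q (Suc k - 1)) powr (1 - \<alpha>))"
      unfolding denom_ratio_def diff_Suc_1 split ereal_less_eq(3)
      using divide_right_mono[of "real (q (Suc k)) / 2" "real (cf_digit \<theta> (Suc k) * q k)" "real (q k) powr \<alpha>"]
      by simp
  qed
  fix K
  show "\<exists>N. \<forall>n\<ge>N. \<exists>k\<ge>K. ereal (real (cf_digit \<theta> n) * real (q (n - 1)) powr (1 - \<alpha>))
    \<le> ereal (1 * denom_ratio \<alpha> k)"
  \<comment> \<open>Starting at \<open>Suc K\<close> also skips the meaningless digit at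
    \<open>n = 0\<close>.\<close>
  proof (rule exI[of _ "Suc K"], intro allI impI)
    fix n assume "Suc K \<le> n"
    then obtain k where k: "n = Suc k" "K \<le> k" by (cases n) auto
    have "real (cf_digit \<theta> (Suc k) * q k) \<le> real (q (Suc k))" using digit[of k] of_nat_mono by blast
    then have "real (cf_digit \<theta> (Suc k)) * real (q k) powr (1 - \<alpha>) \<le> denom_ratio \<alpha> k"
      unfolding split denom_ratio_def by (intro divide_right_mono) simp_all
    then show "\<exists>k\<ge>K. ereal (real (cf_digit \<theta> n) * real (q (n - 1)) powr (1 - \<alpha>))
      \<le> ereal (1 * denom_ratio \<alpha> k)"
      using k by auto
  qed
qed auto

text \<open>An infimum below \<open>y\<close> yields an actual bordered word with quotient below
  \<open>y\<close>, and \<open>border_bounds\<close> estimates that quotient from below by a power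
  of \<open>denom_ratio\<close>.\<close>

lemma repulsion_small_imp:
  assumes "repulsion \<alpha> (sturmian_subshift \<theta>) n < ereal y" "\<alpha> > 0" "3 * q K \<le> n"
  obtains k where "k \<ge> K" "(3 * denom_ratio \<alpha> k) powr (- (1 / \<alpha>)) < y"
proof -
  obtain w W where W: "W \<in> language (sturmian_subshift \<theta>)" "prefix w W" "suffix w W" "W \<noteq> w" "w \<noteq> []"
    "length W = n" and y: "(real (length W) - real (length w)) / real (length w) powr (1 / \<alpha>) < y"
    using assms(1) unfolding repulsion_def Inf_less_iff by auto
  obtain k where k: "real (q k) \<le> real (length W) - real (length w)" "length W < 3 * q (Suc k)"
    using border_bounds[OF W(1-5)] .
  \<comment> \<open>A long \<open>W\<close> forces a large index:
    \<open>3 * q K \<le> n < 3 * q (Suc k)\<close>.\<close>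
  have "q K < q (Suc k)" using k(2) W(6) assms(3) by simp
  then have "K \<le> k" using denom_mono[of "Suc k" K] by (cases "Suc k \<le> K") auto
  moreover have "(3 * denom_ratio \<alpha> k) powr (- (1 / \<alpha>)) = real (q k) / (3 * real (q (Suc k))) powr (1 / \<alpha>)"
    using divide_powr_inverse_eq[of "real (q k)" "3 * real (q (Suc k))" \<alpha>] assms(2)
      denom_pos[of k] denom_pos[of "Suc k"] by (simp add: denom_ratio_def)
  moreover have "\<dots> \<le> (real (length W) - real (length w)) / real (length w) powr (1 / \<alpha>)"
  proof (rule frac_le)
    have "length w \<le> 3 * q (Suc k)" using k(2) prefix_length_le[OF W(2)] by simp
    then have "real (length w) \<le> 3 * real (q (Suc k))"
      by (metis of_nat_le_iff of_nat_mult of_nat_numeral)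
    then show "real (length w) powr (1 / \<alpha>) \<le> (3 * real (q (Suc k))) powr (1 / \<alpha>)"
      using assms(2) by (intro powr_mono2) auto
  qed (use k W(5) in auto)
  ultimately show ?thesis using that y by simp
qed

lemma repulsion_upper_ratio:
  assumes "k \<ge> 3" "\<alpha> > 0"
  shows "repulsion \<alpha> (sturmian_subshift \<theta>) (q (Suc k) + q k - 2)
    \<le> ereal ((1 / 2 * denom_ratio \<alpha> k) powr (- (1 / \<alpha>)))"
proof -
  have "q (Suc k) \<ge> 4" using denom_ge_self[of "Suc k"] assms by simp
  moreover have "(1 / 2 * denom_ratio \<alpha> k) powr (- (1 / \<alpha>)) = real (q k) / (real (q (Suc k)) / 2) powr (1 / \<alpha>)"
    using divide_powr_inverse_eq[of "real (q k)" "real (q (Suc k)) / 2" \<alpha>] assms(2)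
      denom_pos[of k] denom_pos[of "Suc k"] by (simp add: denom_ratio_def mult.commute)
  ultimately show ?thesis using repulsion_upper[of k \<alpha>] assms by simp
qed

text \<open>The exponent \<open>- (1 / \<alpha>)\<close> reverses order, so the roles are exchanged:
  a positive lower limit matches bounded ratios, a finite one matches nonvanishing ratios.\<close>

lemma repulsive_iff:
  assumes \<alpha>: "\<alpha> > 0"
  shows "repulsive \<alpha> (sturmian_subshift \<theta>) \<longleftrightarrow> ratio_bounded \<alpha> \<and> ratio_nonvanishing \<alpha>"
proof -
  define f where "f = repulsion \<alpha> (sturmian_subshift \<theta>)"
  define m where "m k = q (Suc k) + q k - 2" for k
  have low: "f (m k) \<le> ereal ((1 / 2 * denom_ratio \<alpha> k) powr (- (1 / \<alpha>)))" if "k \<ge> 3" for k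
    using repulsion_upper_ratio[OF that \<alpha>] by (simp add: f_def m_def)
  have m: "m k \<ge> k" if "k \<ge> 3" for k
    using denom_ge_self[of k] denom_ge_self[of "Suc k"] that by (simp add: m_def)
  have "f n \<ge> 0" for n unfolding f_def repulsion_def
    by (rule Inf_greatest) (auto dest: prefix_length_le)
  then have "0 \<le> liminf f" by (intro Liminf_bounded) auto
  then have "repulsive \<alpha> (sturmian_subshift \<theta>) \<longleftrightarrow> 0 < liminf f \<and> liminf f < \<infinity>"
    unfolding repulsive_def repulsive_liminf_def f_def[symmetric] by (rule ereal_finite_nonzero_iff)
  moreover have "0 < liminf f \<longleftrightarrow> ratio_bounded \<alpha>"
  proof
    assume "0 < liminf f"
    then obtain e N where e: "e > 0" "\<And>n. n \<ge> N \<Longrightarrow> ereal e \<le> f n"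
      unfolding liminf_positive_iff by blast
    have "denom_ratio \<alpha> k \<le> 2 * e powr (- \<alpha>)" if k: "k \<ge> max 3 N" for k
    proof -
      have "ereal e \<le> f (m k)" using e(2) m[of k] k by simp
      also have "\<dots> \<le> ereal ((1 / 2 * denom_ratio \<alpha> k) powr (- (1 / \<alpha>)))" using low k by simp
      finally have "e \<le> (1 / 2 * denom_ratio \<alpha> k) powr (- (1 / \<alpha>))" by simp
      then have "((1 / 2 * denom_ratio \<alpha> k) powr (- (1 / \<alpha>))) powr (- \<alpha>) \<le> e powr (- \<alpha>)"
        using e(1) \<alpha> by (intro powr_mono2') auto
      then show ?thesis using \<alpha> denom_ratio_pos[of \<alpha> k] by (simp add: powr_powr)
    qed
    moreover have "2 * e powr (- \<alpha>) > 0" using e(1) by simp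
    ultimately show "ratio_bounded \<alpha>" unfolding ratio_bounded_def by blast
  next
    assume "ratio_bounded \<alpha>"
    then obtain B K where B: "B > 0" "\<And>k. k \<ge> K \<Longrightarrow> denom_ratio \<alpha> k \<le> B"
      unfolding ratio_bounded_def by blast
    define y where "y = (3 * B) powr (- (1 / \<alpha>))"
    have "ereal y \<le> f n" if n: "n \<ge> 3 * q K" for n
    proof (rule ccontr)
      assume "\<not> ereal y \<le> f n"
      then have "f n < ereal y" by simp
      then obtain k where "k \<ge> K" and k: "(3 * denom_ratio \<alpha> k) powr (- (1 / \<alpha>)) < y"
        using repulsion_small_imp[OF _ \<alpha> n] unfolding f_def by blast
      have "y \<le> (3 * denom_ratio \<alpha> k) powr (- (1 / \<alpha>))"
        unfolding y_def using B(2)[OF \<open>k \<ge> K\<close>] denom_ratio_pos[of \<alpha> k] \<alpha>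
        by (intro powr_mono2') auto
      then show False using k by simp
    qed
    then show "0 < liminf f" unfolding liminf_positive_iff
      using B(1) by (intro exI[of _ y]) (auto simp: y_def)
  qed
  moreover have "liminf f < \<infinity> \<longleftrightarrow> ratio_nonvanishing \<alpha>"
  proof
    assume "liminf f < \<infinity>"
    then obtain B where B: "B > 0" "\<And>N. \<exists>n\<ge>N. f n < ereal B"
      unfolding liminf_finite_iff by blast
    have "\<exists>k\<ge>K. B powr (- \<alpha>) / 3 \<le> denom_ratio \<alpha> k" for K
    proof -
      obtain n where n: "n \<ge> 3 * q K" "f n < ereal B" using B(2) by blast
      obtain k where k: "k \<ge> K" "(3 * denom_ratio \<alpha> k) powr (- (1 / \<alpha>)) < B"
        using repulsion_small_imp[OF n(2)[unfolded f_def] \<alpha> n(1)] .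
      then have "B powr (- \<alpha>) \<le> 3 * denom_ratio \<alpha> k"
        using powr_minus_inverse_le_iff[of "3 * denom_ratio \<alpha> k" B \<alpha>] B(1) \<alpha> denom_ratio_pos[of \<alpha> k]
        by simp
      then show ?thesis using k(1) by (intro exI[of _ k]) auto
    qed
    then show "ratio_nonvanishing \<alpha>" unfolding ratio_nonvanishing_def
      using B(1) by (intro exI[of _ "B powr (- \<alpha>) / 3"]) auto
  next
    assume "ratio_nonvanishing \<alpha>"
    then obtain e where e: "e > 0" "\<And>K. \<exists>k\<ge>K. e \<le> denom_ratio \<alpha> k"
      unfolding ratio_nonvanishing_def by blast
    define y where "y = (1 / 2 * e) powr (- (1 / \<alpha>))"
    \<comment> \<open>Adding 1 supplies the strict inequality that \<open>liminf_finite_iff\<close>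
      asks for.\<close>
    have "\<exists>n\<ge>N. f n < ereal (y + 1)" for N
    proof -
      obtain k where k: "k \<ge> max 3 N" "e \<le> denom_ratio \<alpha> k" using e(2) by blast
      have "f (m k) \<le> ereal ((1 / 2 * denom_ratio \<alpha> k) powr (- (1 / \<alpha>)))" using low k(1) by simp
      also have "(1 / 2 * denom_ratio \<alpha> k) powr (- (1 / \<alpha>)) \<le> y"
        unfolding y_def using k(2) e(1) \<alpha> by (intro powr_mono2') auto
      also have "ereal y < ereal (y + 1)" by simp
      finally show ?thesis using m[of k] k(1) by (intro exI[of _ "m k"]) auto
    qed
    then show "liminf f < \<infinity>" unfolding liminf_finite_iff
      by (intro exI[of _ "y + 1"]) (auto simp: y_def intro: add_nonneg_pos)
  qed
  ultimately show ?thesis by blast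
qed

end

theorem theorem3p4:
  fixes \<alpha> \<theta> :: real
  assumes "\<alpha> > 1" and "\<theta> \<in> {0..1}" and "\<theta> \<notin> \<rat>"
  shows "(repetitive \<alpha> (sturmian_subshift \<theta>) \<longleftrightarrow> repulsive \<alpha> (sturmian_subshift \<theta>)) \<and>
         (repulsive \<alpha> (sturmian_subshift \<theta>) \<longleftrightarrow> power_finite \<alpha> (sturmian_subshift \<theta>)) \<and>
         (power_finite \<alpha> (sturmian_subshift \<theta>) \<longleftrightarrow> well_approximable \<alpha> \<theta>)"
proof -
  interpret irrational_slope \<theta> using assms by unfold_locales
  have "\<alpha> > 0" using assms by simp
  then show ?thesis
    by (simp add: repetitive_iff repulsive_iff power_finite_iff well_approximable_iff)
qed

end
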